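(* Let $a\in A_\theta^\infty$ with $a\ge 0$ and $a$ invertible in $A_\theta^\infty$, and let $\mu\in\mathbb R$, $\mu>0$. Then the equation $\Delta u=\mu\,e^u-a$ has a solution $u=u^*\in A_\theta^\infty$.
   Context: Fix $\theta\in\mathbb R\smallsetminus\mathbb Q$. $A_\theta$ is the (universal) unital $C^*$-algebra generated by two unitaries $U,V$ with $UV=e^{2\pi i\theta}VU$. Its smooth subalgebra is $A_\theta^\infty=\{\sum_{m,n\in\mathbb Z}c_{m,n}U^mV^n: (c_{m,n})\text{ rapidly decreasing}\}$. The commuting derivations $\delta_1,\delta_2$ of $A_\theta^\infty$ are given by $\delta_1(U)=2\pi iU$, $\delta_1(V)=0$, $\delta_2(U)=0$, $\delta_2(V)=2\pi iV$, so $\delta_1(\sum c_{m,n}U^mV^n)=2\pi i\sum m\,c_{m,n}U^mV^n$ and $\delta_2(\sum c_{m,n}U^mV^n)=2\pi i\sum n\,c_{m,n}U^mV^n$. The Laplacian is $\Delta=\delta_1^2+\delta_2^2$. Positivity $a\ge0$ and the exponential $e^u$ are understood in the $C^*$-algebra $A_\theta$. *)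

theory Defs
  imports "HOL-Analysis.Analysis"
begin

text \<open>Unital complex C*-algebras; the complex scalars extend the inherited real ones, and
  the inherited axiom \<open>norm 1 = 1\<close> only excludes the zero algebra.\<close>

class cstar_algebra = real_normed_algebra_1 + banach +
  fixes scaleC :: "complex \<Rightarrow> 'a \<Rightarrow> 'a" (infixr "*\<^sub>C" 75)
    and star :: "'a \<Rightarrow> 'a"
  assumes scaleC_add_right: "z *\<^sub>C (x + y) = z *\<^sub>C x + z *\<^sub>C y"
    and scaleC_add_left: "(z + w) *\<^sub>C x = z *\<^sub>C x + w *\<^sub>C x"
    and scaleC_scaleC: "z *\<^sub>C w *\<^sub>C x = (z * w) *\<^sub>C x"
    and scaleC_of_real: "complex_of_real r *\<^sub>C x = r *\<^sub>R x"
    and scaleC_mult_left: "(z *\<^sub>C x) * y = z *\<^sub>C (x * y)"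
    and scaleC_mult_right: "x * (z *\<^sub>C y) = z *\<^sub>C (x * y)"
    and norm_scaleC: "norm (z *\<^sub>C x) = cmod z * norm x"
    and star_add: "star (x + y) = star x + star y"
    and star_scaleC: "star (z *\<^sub>C x) = cnj z *\<^sub>C star x"
    and star_mult: "star (x * y) = star y * star x"
    and star_star: "star (star x) = x"
    and norm_star_mult_self: "norm (star x * x) = (norm x)\<^sup>2"

definition unitary :: "'a::cstar_algebra \<Rightarrow> bool" where
  "unitary u \<longleftrightarrow> star u * u = 1 \<and> u * star u = 1"

definition cstar_subalgebra :: "'a::cstar_algebra set \<Rightarrow> bool" where
  "cstar_subalgebra B \<longleftrightarrow> closed B \<and> 1 \<in> B \<and>
     (\<forall>x\<in>B. \<forall>y\<in>B. x + y \<in> B \<and> x * y \<in> B) \<and>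
     (\<forall>x\<in>B. star x \<in> B \<and> (\<forall>z. z *\<^sub>C x \<in> B))"

definition invertible_in :: "'a::cstar_algebra set \<Rightarrow> 'a \<Rightarrow> bool" where
  "invertible_in B x \<longleftrightarrow> x \<in> B \<and> (\<exists>y\<in>B. x * y = 1 \<and> y * x = 1)"

definition spectrum_in :: "'a::cstar_algebra set \<Rightarrow> 'a \<Rightarrow> complex set" where
  "spectrum_in B x = {z. \<not> invertible_in B (x - z *\<^sub>C 1)}"

definition positive_in :: "'a::cstar_algebra set \<Rightarrow> 'a \<Rightarrow> bool" where
  "positive_in B x \<longleftrightarrow> x \<in> B \<and> star x = x \<and> spectrum_in B x \<subseteq> \<real>\<^sub>\<ge>\<^sub>0"

text \<open>The universal unital *-algebra on two unitaries with \<open>u v = \<lambda> v u\<close>,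
  \<open>\<lambda> = exp (2 \<pi> i \<theta>)\<close>, has the monomials \<open>u\<^sup>m v\<^sup>n\<close> as a linear basis, so it is realised on the
  finitely supported functions \<open>c\<close> on pairs of integers, \<open>c\<close> standing for the sum of
  \<open>c (m, n) u\<^sup>m v\<^sup>n\<close>. The phases come from
  \<open>u\<^sup>k v\<^sup>l u\<^sup>m\<^sup>-\<^sup>k v\<^sup>n\<^sup>-\<^sup>l = \<lambda>\<^sup>-\<^sup>l\<^sup>(\<^sup>m\<^sup>-\<^sup>k\<^sup>) u\<^sup>m v\<^sup>n\<close> and
  \<open>(u\<^sup>-\<^sup>m v\<^sup>-\<^sup>n)\<^sup>* = v\<^sup>n u\<^sup>m = \<lambda>\<^sup>-\<^sup>m\<^sup>n u\<^sup>m v\<^sup>n\<close>.\<close>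

definition rot_finsupp :: "(int \<times> int \<Rightarrow> complex) set" where
  "rot_finsupp = {c. finite {p. c p \<noteq> 0}}"

definition rot_mult ::
  "real \<Rightarrow> (int \<times> int \<Rightarrow> complex) \<Rightarrow> (int \<times> int \<Rightarrow> complex) \<Rightarrow> int \<times> int \<Rightarrow> complex" where
  "rot_mult \<theta> c d = (\<lambda>(m, n). \<Sum>(k, l) | c (k, l) \<noteq> 0.
      cis (- 2 * pi * \<theta> * real_of_int (l * (m - k))) * c (k, l) * d (m - k, n - l))"

definition rot_star :: "real \<Rightarrow> (int \<times> int \<Rightarrow> complex) \<Rightarrow> int \<times> int \<Rightarrow> complex" where
  "rot_star \<theta> c = (\<lambda>(m, n). cis (- 2 * pi * \<theta> * real_of_int (m * n)) * cnj (c (- m, - n)))"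

definition rot_cstar_seminorm :: "real \<Rightarrow> ((int \<times> int \<Rightarrow> complex) \<Rightarrow> real) \<Rightarrow> bool" where
  "rot_cstar_seminorm \<theta> p \<longleftrightarrow>
     (\<forall>c\<in>rot_finsupp. 0 \<le> p c \<and> (\<forall>z. p (\<lambda>q. z * c q) = cmod z * p c) \<and>
        p (rot_mult \<theta> (rot_star \<theta> c) c) = (p c)\<^sup>2) \<and>
     (\<forall>c\<in>rot_finsupp. \<forall>d\<in>rot_finsupp.
        p (\<lambda>q. c q + d q) \<le> p c + p d \<and> p (rot_mult \<theta> c d) \<le> p c * p d)"

text \<open>Integer powers of a unitary, whose inverse is its adjoint.\<close>

definition upow :: "'a::cstar_algebra \<Rightarrow> int \<Rightarrow> 'a" where
  "upow u k = (if 0 \<le> k then u ^ nat k else star u ^ nat (- k))"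

definition rot_eval :: "'a::cstar_algebra \<Rightarrow> 'a \<Rightarrow> (int \<times> int \<Rightarrow> complex) \<Rightarrow> 'a" where
  "rot_eval U V c = (\<Sum>(m, n) | c (m, n) \<noteq> 0. c (m, n) *\<^sub>C (upow U m * upow V n))"

definition rot_algebra :: "'a::cstar_algebra \<Rightarrow> 'a \<Rightarrow> 'a set" where
  "rot_algebra U V = cstar_subalgebra hull {U, V}"

text \<open>The C*-algebra generated by \<open>U\<close> and \<open>V\<close> is the universal one on two unitaries with the
  rotation relation, that is, the completion of the *-algebra above in its largest C*-seminorm.
  Since evaluation at \<open>(U, V)\<close> induces a C*-seminorm, it suffices to ask that it dominates every
  other one. The universal algebra is determined up to isomorphism; here it may sit in a larger
  C*-algebra with the same unit, so that a single type can contain it for every \<open>\<theta>\<close>.\<close>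

definition universal_rotation_pair :: "real \<Rightarrow> 'a::cstar_algebra \<Rightarrow> 'a \<Rightarrow> bool" where
  "universal_rotation_pair \<theta> U V \<longleftrightarrow>
     unitary U \<and> unitary V \<and> U * V = cis (2 * pi * \<theta>) *\<^sub>C (V * U) \<and>
     (\<forall>p. rot_cstar_seminorm \<theta> p \<longrightarrow> (\<forall>c\<in>rot_finsupp. p c \<le> norm (rot_eval U V c)))"

definition rapidly_decreasing :: "(int \<times> int \<Rightarrow> complex) \<Rightarrow> bool" where
  "rapidly_decreasing c \<longleftrightarrow>
     (\<forall>k::nat. \<exists>C. \<forall>m n. (1 + \<bar>real_of_int m\<bar> + \<bar>real_of_int n\<bar>) ^ k * cmod (c (m, n)) \<le> C)"

definition has_rot_expansion ::
  "'a::cstar_algebra \<Rightarrow> 'a \<Rightarrow> (int \<times> int \<Rightarrow> complex) \<Rightarrow> 'a \<Rightarrow> bool" where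
  "has_rot_expansion U V c x \<longleftrightarrow> rapidly_decreasing c \<and>
     ((\<lambda>(m, n). c (m, n) *\<^sub>C (upow U m * upow V n)) has_sum x) UNIV"

definition rot_smooth :: "'a::cstar_algebra \<Rightarrow> 'a \<Rightarrow> 'a set" where
  "rot_smooth U V = {x. \<exists>c. has_rot_expansion U V c x}"

text \<open>For a universal rotation pair the coefficients of a smooth element are unique. The
  coefficients and derivations below are only meaningful on \<open>rot_smooth U V\<close>.\<close>

definition rot_coeff :: "'a::cstar_algebra \<Rightarrow> 'a \<Rightarrow> 'a \<Rightarrow> int \<times> int \<Rightarrow> complex" where
  "rot_coeff U V x = (THE c. has_rot_expansion U V c x)"

definition delta1 :: "'a::cstar_algebra \<Rightarrow> 'a \<Rightarrow> 'a \<Rightarrow> 'a" where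
  "delta1 U V x = (\<Sum>\<^sub>\<infinity>(m, n)\<in>UNIV.
     (2 * of_real pi * \<i> * of_int m * rot_coeff U V x (m, n)) *\<^sub>C (upow U m * upow V n))"

definition delta2 :: "'a::cstar_algebra \<Rightarrow> 'a \<Rightarrow> 'a \<Rightarrow> 'a" where
  "delta2 U V x = (\<Sum>\<^sub>\<infinity>(m, n)\<in>UNIV.
     (2 * of_real pi * \<i> * of_int n * rot_coeff U V x (m, n)) *\<^sub>C (upow U m * upow V n))"

definition laplacian :: "'a::cstar_algebra \<Rightarrow> 'a \<Rightarrow> 'a \<Rightarrow> 'a" where
  "laplacian U V x = delta1 U V (delta1 U V x) + delta2 U V (delta2 U V x)"

end

theory Submission imports Defs begin

text \<open>
  Write \<open>\<Delta>\<close> for the Laplacian and choose \<open>\<kappa>, r > 0\<close>. After adding the scalar \<open>ln (\<kappa> / \<mu>)\<close> to the unknown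
  the equation is \<open>\<Delta> u = \<kappa> e\<^sup>u - a\<close>, and its solutions are the fixed points of
  \<open>u \<mapsto> (K - \<Delta>)\<^sup>-\<^sup>1 (K u - \<kappa> e\<^sup>u + a)\<close> for any \<open>K > 0\<close>. For large \<open>K\<close> this map behaves well in
  two different norms, and the proof plays them against each other.

  In the C*-norm it preserves the ball of self-adjoint \<open>u\<close> with \<open>norm u \<le> r\<close>. A positive invertible \<open>a\<close> lies
  in the ball with centre \<open>\<kappa> cosh r\<close> and radius \<open>\<kappa> sinh r\<close> for suitable \<open>\<kappa>\<close> and \<open>r\<close>
  (\<open>positive_invertible_in_ball\<close>), the centred term \<open>K u - \<kappa> (e\<^sup>u - cosh r)\<close> has norm at most
  \<open>K r - \<kappa> sinh r\<close> (\<open>norm_exp_perturbation_le\<close>), and \<open>K (K - \<Delta>)\<^sup>-\<^sup>1\<close> is a contraction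
  (\<open>norm_resolvent_le\<close>). This is the maximum principle for the equation. A contraction
  estimate in the C*-norm would need some monotonicity of the exponential, which is not operator monotone.

  In the norm of the canonical trace it is a strict contraction on this ball, because \<open>e\<^sup>u\<close> is strongly
  monotone for the inner product of the trace (\<open>exp_strongly_monotone\<close>). The iterates therefore converge in
  the trace norm, that is, their coefficients converge in \<open>\<ell>\<^sup>2\<close>. In dimension two the resolvent maps
  \<open>\<ell>\<^sup>2\<close> coefficients to \<open>\<ell>\<^sup>1\<close> coefficients (\<open>wiener_norm_resolvent_le_norm2\<close>), so they converge even
  absolutely and the limit is an element of the algebra. Finally, elements whose coefficients are summable with a
  polynomial weight form a Banach algebra, which is closed under \<open>exp\<close>, and the resolvent gains two orders
  of the weight; hence the fixed point is smooth.

  Two ingredients come from the irrationality of \<open>\<theta>\<close> through inner automorphisms by monomials in \<open>U\<close> and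
  \<open>V\<close>: averaging them bounds each coefficient by the C*-norm, which yields the canonical trace, and second
  differences along them approximate the Laplacian, which yields the bound on the resolvent. Spectral theory is
  replaced by square roots from the binomial series and by sums of two squares
  (\<open>norm_le_if_squares_sum\<close>).
\<close>

section \<open>Scalars and involution in C*-algebras\<close>

lemma scaleC_one [simp]: "1 *\<^sub>C x = (x::'a::cstar_algebra)"
  using scaleC_of_real[of 1 x] by simp

lemma scaleC_zero_left [simp]: "0 *\<^sub>C x = (0::'a::cstar_algebra)"
  using scaleC_of_real[of 0 x] by simp

lemma scaleC_scaleR: "z *\<^sub>C (r *\<^sub>R x) = r *\<^sub>R (z *\<^sub>C (x::'a::cstar_algebra))"
  by (metis mult.commute scaleC_of_real scaleC_scaleC)

lemma scaleR_left_scaleC: "(r *\<^sub>R z) *\<^sub>C x = r *\<^sub>R (z *\<^sub>C (x::'a::cstar_algebra))"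
  by (metis scaleC_of_real scaleC_scaleC scaleR_conv_of_real)

lemma bounded_linear_scaleC_right: "bounded_linear (\<lambda>x::'a::cstar_algebra. z *\<^sub>C x)"
  by (rule bounded_linear_intro[where K="cmod z"])
     (simp_all add: scaleC_add_right scaleC_scaleR norm_scaleC mult.commute)

lemma bounded_linear_scaleC_left: "bounded_linear (\<lambda>z. z *\<^sub>C (x::'a::cstar_algebra))"
  by (rule bounded_linear_intro[where K="norm x"])
     (simp_all add: scaleC_add_left scaleR_left_scaleC norm_scaleC)

lemma scaleC_diff_right: "z *\<^sub>C (x - y::'a::cstar_algebra) = z *\<^sub>C x - z *\<^sub>C y"
  by (rule linear_diff[OF bounded_linear.linear[OF bounded_linear_scaleC_right]])

lemma scaleC_minus_left: "(- z) *\<^sub>C (x::'a::cstar_algebra) = - (z *\<^sub>C x)"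
  by (rule linear_neg[OF bounded_linear.linear[OF bounded_linear_scaleC_left]])

lemma scaleC_diff_left: "(z - w) *\<^sub>C (x::'a::cstar_algebra) = z *\<^sub>C x - w *\<^sub>C x"
  by (rule linear_diff[OF bounded_linear.linear[OF bounded_linear_scaleC_left]])

lemma scaleC_sum_left: "(\<Sum>i\<in>F. z i) *\<^sub>C (x::'a::cstar_algebra) = (\<Sum>i\<in>F. z i *\<^sub>C x)"
  using linear_sum[OF bounded_linear.linear[OF bounded_linear_scaleC_left]] by blast

lemma scaleC_sum_right: "z *\<^sub>C (\<Sum>i\<in>F. f i) = (\<Sum>i\<in>F. z *\<^sub>C (f i ::'a::cstar_algebra))"
  using linear_sum[OF bounded_linear.linear[OF bounded_linear_scaleC_right]] by blast

lemma star_scaleR: "star (r *\<^sub>R x) = r *\<^sub>R star (x::'a::cstar_algebra)"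
  by (metis complex_cnj_complex_of_real scaleC_of_real star_scaleC)

lemma norm_star: "norm (star x) = norm (x::'a::cstar_algebra)"
proof -
  have le: "norm y \<le> norm (star y)" for y :: 'a
  proof (cases "y = 0")
    case False
    have "(norm y)\<^sup>2 \<le> norm (star y) * norm y"
      by (metis norm_mult_ineq norm_star_mult_self)
    then show ?thesis using False by (simp add: power2_eq_square)
  qed simp
  show ?thesis using le[of x] le[of "star x"] by (simp add: star_star)
qed

lemma bounded_linear_star: "bounded_linear (star :: 'a::cstar_algebra \<Rightarrow> 'a)"
  by (rule bounded_linear_intro[where K=1]) (simp_all add: star_add star_scaleR norm_star)

lemma star_zero [simp]: "star (0::'a::cstar_algebra) = 0"
  using bounded_linear_star linear_simps(3) by blast

lemma star_diff: "star (x - y::'a::cstar_algebra) = star x - star y"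
  by (rule linear_diff[OF bounded_linear.linear[OF bounded_linear_star]])

lemma star_one [simp]: "star (1::'a::cstar_algebra) = 1"
  by (metis mult_1 mult_1_right star_mult star_star)

lemma star_power: "star (x ^ n) = star (x::'a::cstar_algebra) ^ n"
  by (induction n) (simp_all add: star_mult power_commutes)

lemma star_exp: "star (exp x) = exp (star (x::'a::cstar_algebra))"
proof -
  have "(\<lambda>n. star (x ^ n /\<^sub>R fact n)) sums star (exp x)"
    by (rule bounded_linear.sums[OF bounded_linear_star exp_converges])
  then have "(\<lambda>n. star x ^ n /\<^sub>R fact n) sums star (exp x)"
    by (simp add: star_scaleR star_power)
  then show ?thesis
    using exp_converges sums_unique2 by blast
qed

section \<open>Functions of a self-adjoint element\<close>

text \<open>Exhibiting \<open>f\<close> as the real part of \<open>f + i z\<close>, a multiple of a unitary, bounds its norm. To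
  show \<open>norm f \<le> B\<close> it is thus enough to find a square root of \<open>B\<^sup>2 - f\<^sup>2\<close> that commutes with \<open>f\<close>.\<close>

lemma norm_le_if_squares_sum:
  fixes f z :: "'a::cstar_algebra"
  assumes "star f = f" "star z = z" "f * z = z * f" "f * f + z * z = (B\<^sup>2) *\<^sub>R 1" "B \<ge> 0"
  shows "norm f \<le> B"
proof -
  define x where "x = f + \<i> *\<^sub>C z"
  have sx: "star x = f - \<i> *\<^sub>C z"
    by (simp add: x_def star_add star_scaleC assms scaleC_minus_left)
  have "star x * x = f * f + z * z"
    unfolding sx unfolding x_def
    by (simp add: algebra_simps scaleC_mult_left scaleC_mult_right scaleC_scaleC assms(3) scaleC_minus_left scaleC_diff_right)
  then have "(norm x)\<^sup>2 = B\<^sup>2"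
    using norm_star_mult_self[of x] assms(4) by simp
  then have nx: "norm x = B"
    using assms(5) by simp
  have "2 *\<^sub>R f = x + star x"
    unfolding sx by (simp add: x_def scaleR_2)
  then have "2 * norm f \<le> norm x + norm (star x)"
    by (metis abs_numeral norm_scaleR norm_triangle_ineq)
  then show ?thesis
    by (simp add: norm_star nx)
qed

text \<open>Asking for the double commutant, rather than for commutation with \<open>y\<close> only, makes all elements obtained
  from \<open>y\<close> by real power series commute with each other.\<close>

definition sa_bicommutant :: "'a::cstar_algebra \<Rightarrow> 'a set" where
  "sa_bicommutant y = {x. star x = x \<and> (\<forall>w. w * y = y * w \<longrightarrow> w * x = x * w)}"

context
  fixes y :: "'a::cstar_algebra"
begin

lemma sa_bicommutant_star: "x \<in> sa_bicommutant y \<Longrightarrow> star x = x"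
  by (simp add: sa_bicommutant_def)

lemma sa_bicommutant_commute:
  "x \<in> sa_bicommutant y \<Longrightarrow> x' \<in> sa_bicommutant y \<Longrightarrow> x * x' = x' * x"
proof -
  assume x: "x \<in> sa_bicommutant y" and x': "x' \<in> sa_bicommutant y"
  from x have "y * x = x * y" by (simp add: sa_bicommutant_def)
  then show "x * x' = x' * x" using x' by (simp add: sa_bicommutant_def)
qed

lemma sa_bicommutant_self: "star y = y \<Longrightarrow> y \<in> sa_bicommutant y"
  by (simp add: sa_bicommutant_def)

lemma sa_bicommutant_one: "1 \<in> sa_bicommutant y"
  by (simp add: sa_bicommutant_def)

lemma sa_bicommutant_add:
  "x \<in> sa_bicommutant y \<Longrightarrow> x' \<in> sa_bicommutant y \<Longrightarrow> x + x' \<in> sa_bicommutant y"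
  by (simp add: sa_bicommutant_def star_add algebra_simps)

lemma sa_bicommutant_scaleR: "x \<in> sa_bicommutant y \<Longrightarrow> r *\<^sub>R x \<in> sa_bicommutant y"
  by (simp add: sa_bicommutant_def star_scaleR)

lemma sa_bicommutant_diff:
  "x \<in> sa_bicommutant y \<Longrightarrow> x' \<in> sa_bicommutant y \<Longrightarrow> x - x' \<in> sa_bicommutant y"
  by (simp add: sa_bicommutant_def star_diff algebra_simps)

lemma sa_bicommutant_mult:
  assumes "x \<in> sa_bicommutant y" "x' \<in> sa_bicommutant y" shows "x * x' \<in> sa_bicommutant y"
  unfolding sa_bicommutant_def
proof (intro CollectI conjI allI impI)
  show "star (x * x') = x * x'"
    using assms by (simp add: star_mult sa_bicommutant_star sa_bicommutant_commute)
  fix w assume "w * y = y * w"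
  then have "w * x = x * w" "w * x' = x' * w"
    using assms unfolding sa_bicommutant_def by blast+
  then show "w * (x * x') = x * x' * w" by (metis mult.assoc)
qed

lemma sa_bicommutant_power: "x \<in> sa_bicommutant y \<Longrightarrow> x ^ n \<in> sa_bicommutant y"
  by (induction n) (simp_all add: sa_bicommutant_one sa_bicommutant_mult)

lemma sa_bicommutant_sums:
  assumes "\<And>n. f n \<in> sa_bicommutant y" "f sums x"
  shows "x \<in> sa_bicommutant y"
  unfolding sa_bicommutant_def
proof (intro CollectI conjI allI impI)
  have "(\<lambda>n. star (f n)) sums star x"
    by (rule bounded_linear.sums[OF bounded_linear_star assms(2)])
  then show "star x = x"
    using assms(1,2) sa_bicommutant_star sums_unique2 by fastforce
  fix w assume w: "w * y = y * w"
  have "(\<lambda>n. w * f n) sums (w * x)"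
    by (rule bounded_linear.sums[OF bounded_linear_mult_right assms(2)])
  moreover have "w * f n = f n * w" for n
    using assms(1) w unfolding sa_bicommutant_def by blast
  ultimately have "(\<lambda>n. f n * w) sums (w * x)" by simp
  moreover have "(\<lambda>n. f n * w) sums (x * w)"
    by (rule bounded_linear.sums[OF bounded_linear_mult_left assms(2)])
  ultimately show "w * x = x * w" using sums_unique2 by blast
qed

lemma sa_bicommutant_exp: "x \<in> sa_bicommutant y \<Longrightarrow> exp x \<in> sa_bicommutant y"
  by (rule sa_bicommutant_sums[OF _ exp_converges])
     (intro sa_bicommutant_scaleR sa_bicommutant_power)

end

text \<open>Partial sums of the coefficients \<open>(-1)\<^sup>k (1/2 choose k)\<close> telescope to
  \<open>(-1)\<^sup>n (-1/2 choose n) \<ge> 0\<close>, and all coefficients beyond the first are negative.\<close>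

lemma sqrt_series_coeff_sign:
  "(-1) ^ Suc k * ((1/2::real) gchoose Suc k) \<le> 0" "(-1) ^ k * ((-1/2::real) gchoose k) \<ge> 0"
proof -
  show nn: "(-1) ^ k * ((-1/2::real) gchoose k) \<ge> 0" for k
  proof (induction k)
    case (Suc k)
    have "(-1) ^ Suc k * ((-1/2::real) gchoose Suc k)
       = ((1/2 + real k) / real (Suc k)) * ((-1) ^ k * ((-1/2::real) gchoose k))"
      by (simp add: gbinomial_Suc_rec field_simps)
    then show ?case using Suc by simp
  qed simp
  have "(1/2::real) gchoose Suc k = (1/2) / real (Suc k) * ((-1/2) gchoose k)"
    using gbinomial_absorption'[of "Suc k" "1/2::real"] by simp
  then have "(-1) ^ Suc k * ((1/2::real) gchoose Suc k)
      = - ((1/2) / real (Suc k)) * ((-1) ^ k * ((-1/2) gchoose k))"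
    by simp
  then show "(-1) ^ Suc k * ((1/2::real) gchoose Suc k) \<le> 0"
    using nn[of k] by (smt (verit) mult_minus_left mult_nonneg_nonneg divide_nonneg_nonneg of_nat_0_le_iff)
qed

text \<open>The absolute summability includes the end point of the disc of convergence, so square roots of \<open>1 - z\<close>
  exist up to \<open>norm z = 1\<close>.\<close>

lemma sqrt_series_abs_summable:
  "summable (\<lambda>k. \<bar>(-1) ^ k * ((1/2::real) gchoose k)\<bar>)"
proof (rule summableI_nonneg_bounded)
  define b where "b k = (-1) ^ k * ((1/2::real) gchoose k)" for k
  show "(\<Sum>k<n. \<bar>(-1) ^ k * ((1/2::real) gchoose k)\<bar>) \<le> 2" for n
  proof (cases n)
    case (Suc n')
    have "(\<Sum>k\<le>n'. b k) = (-1) ^ n' * ((1/2 - 1::real) gchoose n')"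
      unfolding b_def using gbinomial_sum_lower_neg[of "1/2::real" n'] by (simp add: mult.commute)
    also have "\<dots> \<ge> 0" using sqrt_series_coeff_sign(2)[of n'] by simp
    finally have "(\<Sum>k\<le>n'. b k) \<ge> 0" .
    moreover have "(\<Sum>k\<le>n'. \<bar>b k\<bar>) = (\<Sum>k\<le>n'. (if k = 0 then 2 else 0) - b k)"
      by (rule sum.cong[OF refl])
         (metis (full_types) abs_of_nonpos b_def diff_0 diff_add_cancel gbinomial_0(1) add_diff_cancel_left'
            mult_1_right not0_implies_Suc one_add_one power_0 abs_one sqrt_series_coeff_sign(1))
    moreover have "\<dots> = 2 - (\<Sum>k\<le>n'. b k)"
      by (simp add: sum_subtractf)
    ultimately show ?thesis
      unfolding b_def[symmetric] Suc lessThan_Suc_atMost by linarith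
  qed simp
qed simp

lemma exists_sqrt:
  fixes z :: "'a::cstar_algebra"
  assumes z: "z \<in> sa_bicommutant y" "norm z \<le> 1"
  shows "\<exists>s\<in>sa_bicommutant y. s * s = 1 - z"
proof -
  \<comment> \<open>the coefficients of the power series of \<open>sqrt (1 - z)\<close>\<close>
  define b where "b k = (-1) ^ k * ((1/2::real) gchoose k)" for k
  define f where "f k = b k *\<^sub>R z ^ k" for k
  have nf: "norm (f k) \<le> \<bar>b k\<bar>" for k
  proof -
    have "norm (z ^ k) \<le> 1"
      by (meson norm_ge_zero norm_power_ineq order_trans power_le_one z(2))
    then show ?thesis
      by (simp add: f_def mult_left_le)
  qed
  have sm: "summable (\<lambda>k. norm (f k))"
    by (rule summable_comparison_test'[OF sqrt_series_abs_summable])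
       (use nf b_def in simp)
  define s where "s = suminf f"
  have fs: "f sums s"
    unfolding s_def using sm summable_norm_cancel summable_sums by blast
  have sB: "s \<in> sa_bicommutant y"
    by (rule sa_bicommutant_sums[OF _ fs]) (simp add: f_def sa_bicommutant_scaleR sa_bicommutant_power z)
  have "(\<lambda>k. \<Sum>i\<le>k. f i * f (k - i)) sums (s * s)"
    unfolding s_def by (rule Cauchy_product_sums[OF sm sm])
  moreover have "(\<Sum>i\<le>k. f i * f (k - i)) = (if k = 0 then 1 else 0) + (if k = 1 then - z else 0)" for k
  proof -
    have "(\<Sum>i\<le>k. f i * f (k - i))
        = (\<Sum>i\<le>k. ((-1) ^ k * (((1/2::real) gchoose i) * ((1/2) gchoose (k - i)))) *\<^sub>R z ^ k)"
    proof (rule sum.cong[OF refl])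
      fix i assume "i \<in> {..k}"
      then have "i + (k - i) = k" by simp
      then have "(-1::real) ^ i * (-1) ^ (k - i) = (-1) ^ k" "z ^ i * z ^ (k - i) = z ^ k"
        by (metis power_add)+
      then show "f i * f (k - i) = ((-1) ^ k * (((1/2::real) gchoose i) * ((1/2) gchoose (k - i)))) *\<^sub>R z ^ k"
        unfolding f_def b_def by (simp add: mult.commute mult.left_commute)
    qed
    also have "\<dots> = ((-1) ^ k * (\<Sum>i\<le>k. ((1/2::real) gchoose i) * ((1/2) gchoose (k - i)))) *\<^sub>R z ^ k"
      by (simp add: scaleR_sum_left sum_distrib_left)
    also have "(\<Sum>i\<le>k. ((1/2::real) gchoose i) * ((1/2) gchoose (k - i))) = (1/2 + 1/2) gchoose k"
      using gbinomial_Vandermonde[of "1/2::real" "1/2" k] by (simp add: atLeast0AtMost)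
    also have "\<dots> = of_nat (1 choose k)"
      using binomial_gbinomial[of 1 k, where 'a=real] by simp
    finally show ?thesis
      by (cases k; cases "k - 1") auto
  qed
  moreover have "(\<lambda>k::nat. (if k = 0 then 1 else 0) + (if k = 1 then - z else 0)) sums (1 + - z)"
    by (intro sums_add sums_single)
  ultimately have "s * s = 1 - z"
    using sums_unique2 by fastforce
  with sB show ?thesis by blast
qed

text \<open>In spectral terms, \<open>norm x\<close> or \<open>- norm x\<close> is in the spectrum of a self-adjoint \<open>x\<close>. If
  \<open>N\<^sup>2 - x\<^sup>2\<close> with \<open>N = norm x\<close> had an inverse \<open>y\<close>, it would be at least \<open>1 / c\<close> for every
  \<open>c \<ge> norm y\<close>, so \<open>x\<^sup>2\<close> would stay strictly below its own norm. The positivity is witnessed by a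
  square root \<open>s\<close> of \<open>N\<^sup>2 - x\<^sup>2\<close> and a square root \<open>q\<close> of \<open>1 - y / c\<close>: with \<open>z = q s\<close> one has
  \<open>x\<^sup>2 + z\<^sup>2 = N\<^sup>2 - 1 / c\<close>.\<close>

lemma norm_sq_minus_square_not_invertible:
  fixes x y :: "'a::cstar_algebra"
  assumes sx: "star x = x" and x0: "x \<noteq> 0"
    and inv: "y * (((norm x)\<^sup>2) *\<^sub>R 1 - x * x) = 1" "(((norm x)\<^sup>2) *\<^sub>R 1 - x * x) * y = 1"
  shows False
proof -
  define N where "N = norm x"
  define D where "D = sa_bicommutant x"
  define d where "d = (N\<^sup>2) *\<^sub>R 1 - x * x"
  have N: "N > 0" using x0 by (simp add: N_def)
  have xD: "x \<in> D" by (simp add: D_def sa_bicommutant_self sx)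
  have dD: "d \<in> D" unfolding d_def D_def
    using xD[unfolded D_def] by (intro sa_bicommutant_diff sa_bicommutant_scaleR sa_bicommutant_one sa_bicommutant_mult)
  have yd: "y * d = 1" and dy: "d * y = 1" using inv by (simp_all add: d_def N_def)
  have yD: "y \<in> D" unfolding D_def sa_bicommutant_def
  proof (intro CollectI conjI allI impI)
    have "d * star y = 1"
      using arg_cong[OF yd, of star] dD by (simp add: star_mult D_def sa_bicommutant_star)
    then show "star y = y" using yd by (metis mult.assoc mult_1_left mult_1_right)
    fix w assume "w * x = x * w"
    then have "w * d = d * w" using dD by (simp add: D_def sa_bicommutant_def)
    then show "w * y = y * w" using yd dy by (metis mult.assoc mult_1_left mult_1_right)
  qed
  have "norm ((1 / N\<^sup>2) *\<^sub>R (x * x)) \<le> 1"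
    using N norm_mult_ineq[of x x] by (simp add: power2_eq_square N_def)
  moreover have "(1 / N\<^sup>2) *\<^sub>R (x * x) \<in> sa_bicommutant x"
    using xD unfolding D_def by (intro sa_bicommutant_scaleR sa_bicommutant_mult)
  ultimately obtain s0 where s0: "s0 \<in> sa_bicommutant x" "s0 * s0 = 1 - (1 / N\<^sup>2) *\<^sub>R (x * x)"
    using exists_sqrt by blast
  define s where "s = N *\<^sub>R s0"
  have sD: "s \<in> D" by (simp add: s_def D_def s0 sa_bicommutant_scaleR)
  have ss: "s * s = d"
    using N by (simp add: s_def s0 d_def scaleR_diff_right power2_eq_square)
  \<comment> \<open>the second bound only serves to make \<open>N\<^sup>2 - 1 / c\<close> nonnegative\<close>
  define c where "c = max (norm y) (1 / N\<^sup>2)"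
  have c: "c > 0" "norm y \<le> c" "1 / c \<le> N\<^sup>2"
  proof -
    show "c > 0" using N by (simp add: c_def less_max_iff_disj)
    show "norm y \<le> c" by (simp add: c_def)
    have "1 / N\<^sup>2 \<le> c" by (simp add: c_def)
    then show "1 / c \<le> N\<^sup>2" using N \<open>c > 0\<close> by (simp add: field_simps)
  qed
  have "norm ((1 / c) *\<^sub>R y) \<le> 1" using c by simp
  moreover have "(1 / c) *\<^sub>R y \<in> sa_bicommutant x"
    using yD by (simp add: D_def sa_bicommutant_scaleR)
  ultimately obtain q0 where q0: "q0 \<in> sa_bicommutant x" "q0 * q0 = 1 - (1 / c) *\<^sub>R y"
    using exists_sqrt by blast
  define z where "z = q0 * s"
  have zD: "z \<in> D" using q0 sD by (simp add: z_def D_def sa_bicommutant_mult)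
  have "z * z = (q0 * q0) * (s * s)"
    unfolding z_def using sa_bicommutant_commute[of s x q0] sD q0(1) by (metis D_def mult.assoc)
  also have "\<dots> = d - (1 / c) *\<^sub>R 1"
    by (simp add: q0 ss left_diff_distrib yd)
  finally have "x * x + z * z = (N\<^sup>2 - 1 / c) *\<^sub>R 1"
    by (simp add: d_def scaleR_diff_left)
  also have "N\<^sup>2 - 1 / c = (sqrt (N\<^sup>2 - 1 / c))\<^sup>2"
    using c by simp
  finally have "norm x \<le> sqrt (N\<^sup>2 - 1 / c)"
    using xD zD c unfolding D_def
    by (intro norm_le_if_squares_sum[where z=z])
       (auto simp: sa_bicommutant_star intro: sa_bicommutant_commute)
  also have "\<dots> < sqrt (N\<^sup>2)"
    using c by (intro real_sqrt_less_mono) simp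
  finally show False using N by (simp add: N_def)
qed

lemma neumann_inverse:
  fixes x :: "'a::cstar_algebra"
  assumes "norm x < t"
  shows "\<exists>y. y * (t *\<^sub>R 1 - x) = 1 \<and> (t *\<^sub>R 1 - x) * y = 1"
proof -
  have t: "t > 0" using assms norm_ge_zero[of x] by linarith
  define z where "z = (1 / t) *\<^sub>R x"
  have z: "norm z < 1" using assms t by (simp add: z_def)
  have sm: "summable (\<lambda>n. z ^ n)"
    by (rule summable_comparison_test'[OF summable_geometric[of "norm z"]])
       (use z norm_power_ineq[of z] in auto)
  define w where "w = (\<Sum>n. z ^ n)"
  have "(\<lambda>n. z ^ n - z ^ Suc n) sums (z ^ 0 - 0)"
    using telescope_sums'[OF summable_LIMSEQ_zero[OF sm]] by simp
  moreover have "(\<lambda>n. z ^ n - z * z ^ n) sums (w - z * w)" "(\<lambda>n. z ^ n - z ^ n * z) sums (w - w * z)"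
    unfolding w_def
    by (intro sums_diff summable_sums sm bounded_linear.sums[OF bounded_linear_mult_right]
      bounded_linear.sums[OF bounded_linear_mult_left])+
  ultimately have w: "w - z * w = 1" "w - w * z = 1"
    using sums_unique2 by (auto simp: power_commutes)
  have x: "x = t *\<^sub>R z" using t by (simp add: z_def)
  show ?thesis
    using w t by (intro exI[of _ "(1/t) *\<^sub>R w"]) (simp add: x algebra_simps)
qed

text \<open>If \<open>N = norm (t - a)\<close> were at least \<open>t = norm a\<close>, both factors of \<open>N\<^sup>2 - (t - a)\<^sup>2\<close> would be
  invertible: \<open>a + (N - t)\<close> because the spectrum of \<open>a\<close> contains no number \<open>\<le> 0\<close>, and \<open>N + t - a\<close> by the
  Neumann series.\<close>

lemma positive_invertible_in_ball:
  fixes a :: "'a::cstar_algebra"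
  assumes pos: "positive_in A a" and inv: "a * a' = 1" "a' * a = 1"
  shows "norm (a - norm a *\<^sub>R 1) < norm a"
proof (rule ccontr)
  define t where "t = norm a"
  define x where "x = t *\<^sub>R 1 - a"
  define N where "N = norm x"
  have sa: "star a = a" using pos by (simp add: positive_in_def)
  have a0: "a \<noteq> 0" using inv by auto
  then have t: "t > 0" by (simp add: t_def)
  assume "\<not> ?thesis"
  then have N: "N \<ge> t" by (simp add: N_def x_def t_def norm_minus_commute)
  have sx: "star x = x" by (simp add: x_def star_diff star_scaleR sa)
  have "\<exists>p. p * (a + e *\<^sub>R 1) = 1 \<and> (a + e *\<^sub>R 1) * p = 1" if "e \<ge> 0" for e
  proof (cases "e = 0")
    case False
    then have "complex_of_real (- e) \<notin> spectrum_in A a"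
      using pos that unfolding positive_in_def by (auto simp: subset_iff nonneg_Reals_def complex_eq_iff)
    then obtain p where "(a - complex_of_real (- e) *\<^sub>C 1) * p = 1" "p * (a - complex_of_real (- e) *\<^sub>C 1) = 1"
      unfolding spectrum_in_def invertible_in_def by blast
    then show ?thesis unfolding scaleC_of_real by auto
  qed (use inv in auto)
  from this[of "N - t"] N obtain p where p: "p * (a + (N - t) *\<^sub>R 1) = 1" "(a + (N - t) *\<^sub>R 1) * p = 1"
    by auto
  have m: "a + (N - t) *\<^sub>R 1 = N *\<^sub>R 1 - x" by (simp add: x_def algebra_simps)
  obtain q where q: "q * ((N + t) *\<^sub>R 1 - a) = 1" "((N + t) *\<^sub>R 1 - a) * q = 1"
    using neumann_inverse[of a "N + t"] N t t_def by auto
  have n: "(N + t) *\<^sub>R 1 - a = N *\<^sub>R 1 + x" by (simp add: x_def algebra_simps)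
  have f: "(N\<^sup>2) *\<^sub>R 1 - x * x = (N *\<^sub>R 1 - x) * (N *\<^sub>R 1 + x)"
    by (simp add: algebra_simps power2_eq_square)
  have "(q * p) * ((N\<^sup>2) *\<^sub>R 1 - x * x) = 1"
    unfolding f using p q unfolding m n by (metis mult.assoc mult_1_right)
  moreover have "((N\<^sup>2) *\<^sub>R 1 - x * x) * (q * p) = 1"
    unfolding f using p q unfolding m n by (metis mult.assoc mult_1_right)
  moreover have "x \<noteq> 0" using N t N_def by auto
  ultimately show False
    using norm_sq_minus_square_not_invertible[OF sx] N_def by blast
qed

lemma exp_scaleR_one: "exp (r *\<^sub>R (1::'a::{real_normed_algebra_1,banach})) = exp r *\<^sub>R 1"
  using exp_of_real[of r, where 'a='a] by (simp add: of_real_def)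

text \<open>The entire function \<open>(e\<^sup>z - 1) / z\<close> supplies the divided differences of the exponential.\<close>

lemma exists_exp_quotient:
  fixes z :: "'a::cstar_algebra"
  assumes z: "z \<in> sa_bicommutant y"
  shows "\<exists>q\<in>sa_bicommutant y. z * q = exp z - 1 \<and> norm q \<le> exp (norm z)"
proof -
  define f where "f n = z ^ n /\<^sub>R fact (Suc n)" for n
  have nf: "norm (f n) \<le> norm z ^ n / fact n" for n
  proof -
    have "norm (f n) = norm (z ^ n) / fact (Suc n)"
      by (simp add: f_def divide_inverse mult.commute)
    also have "\<dots> \<le> norm z ^ n / fact n"
      by (intro frac_le norm_power_ineq) (auto simp: fact_mono)
    finally show ?thesis .
  qed
  have sme: "(\<lambda>n. norm z ^ n / fact n) sums exp (norm z)"
    using exp_converges[of "norm z"] by (simp add: divide_inverse mult.commute)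
  have sm: "summable (\<lambda>n. norm (f n))"
    by (rule summable_comparison_test'[OF sums_summable[OF sme]]) (use nf in auto)
  define q where "q = suminf f"
  have fq: "f sums q" unfolding q_def using sm summable_norm_cancel summable_sums by blast
  have "norm q \<le> (\<Sum>n. norm (f n))" unfolding q_def by (rule summable_norm[OF sm])
  also have "\<dots> \<le> exp (norm z)"
    using suminf_le[OF nf sm sums_summable[OF sme]] sums_unique[OF sme] by simp
  finally have "norm q \<le> exp (norm z)" .
  moreover have "q \<in> sa_bicommutant y"
    by (rule sa_bicommutant_sums[OF _ fq]) (simp add: f_def sa_bicommutant_scaleR sa_bicommutant_power z del: fact_Suc)
  moreover have "(\<lambda>n. z * f n) sums (z * q)"
    by (rule bounded_linear.sums[OF bounded_linear_mult_right fq])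
  then have "(\<lambda>n. z ^ Suc n /\<^sub>R fact (Suc n)) sums (z * q)"
    by (simp add: f_def del: fact_Suc)
  then have "z * q = exp z - 1"
    using sums_Suc_iff[of "\<lambda>n. z ^ n /\<^sub>R fact n" "exp z - 1"] exp_converges[of z] sums_unique2 by fastforce
  ultimately show ?thesis by blast
qed

text \<open>On \<open>[-r, r]\<close> the function \<open>F x = K x - \<kappa> (e\<^sup>x - cosh r)\<close> is increasing for large \<open>K\<close>, and the constant
  \<open>\<kappa> cosh r\<close> is chosen such that its values at the end points are \<open>B\<close> and \<open>- B\<close> with \<open>B = K r - \<kappa> sinh r\<close>. The norm
  bound for a self-adjoint element amounts to a square root of \<open>B\<^sup>2 - F\<^sup>2 = (B - F) (B + F)\<close>. The two
  factors are \<open>r - x\<close> and \<open>r + x\<close>, whose product is \<open>r\<^sup>2 (1 - (x / r)\<^sup>2)\<close>, times functions of the form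
  \<open>K (1 - n)\<close>, where \<open>n\<close> is \<open>\<kappa> / K\<close> times a divided difference of \<open>exp\<close>. Such a divided difference is at
  most \<open>e\<^bsup>3r\<^esup>\<close> in norm, hence the condition on \<open>K\<close>.\<close>

lemma norm_exp_perturbation_le:
  fixes y :: "'a::cstar_algebra"
  assumes sy: "star y = y" and ny: "norm y \<le> r" and k: "\<kappa> > 0" and K: "K \<ge> \<kappa> * exp (3 * r)" and r: "r > 0"
  shows "norm (K *\<^sub>R y - \<kappa> *\<^sub>R (exp y - cosh r *\<^sub>R 1)) \<le> K * r - \<kappa> * sinh r"
proof -
  let ?D = "sa_bicommutant y"
  note D_intros = sa_bicommutant_add sa_bicommutant_diff sa_bicommutant_scaleR sa_bicommutant_mult
    sa_bicommutant_one sa_bicommutant_exp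
  define F where "F = K *\<^sub>R y - \<kappa> *\<^sub>R (exp y - cosh r *\<^sub>R 1)"
  define B where "B = K * r - \<kappa> * sinh r"
  have K0: "K > 0" using k K by (smt (verit) exp_gt_zero mult_pos_pos)
  have yD: "y \<in> ?D" using sy by (rule sa_bicommutant_self)
  have FD: "F \<in> ?D" unfolding F_def using yD by (intro D_intros)
  define z1 where "z1 = r *\<^sub>R 1 - y"
  define z2 where "z2 = r *\<^sub>R 1 + y"
  have z1D: "z1 \<in> ?D" and z2D: "z2 \<in> ?D" unfolding z1_def z2_def using yD by (intro D_intros; simp)+
  have nz: "norm z1 \<le> 2 * r" "norm z2 \<le> 2 * r"
    unfolding z1_def z2_def using norm_triangle_ineq4[of "r *\<^sub>R 1" y] norm_triangle_ineq[of "r *\<^sub>R 1" y] ny r by auto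
  have cm: "a * b = b * a" if "a \<in> ?D" "b \<in> ?D" for a b using sa_bicommutant_commute that .
  obtain p1 where p1: "p1 \<in> ?D" "z1 * p1 = exp z1 - 1" "norm p1 \<le> exp (norm z1)"
    using exists_exp_quotient[OF z1D] by blast
  obtain p2 where p2: "p2 \<in> ?D" "z2 * p2 = exp z2 - 1" "norm p2 \<le> exp (norm z2)"
    using exists_exp_quotient[OF z2D] by blast
  define q1 where "q1 = exp y * p1"
  define q2 where "q2 = exp (- r) *\<^sub>R p2"
  have eyD: "exp y \<in> ?D" using yD by (rule sa_bicommutant_exp)
  have qD: "q1 \<in> ?D" "q2 \<in> ?D" unfolding q1_def q2_def using p1(1) p2(1) eyD by (auto intro: sa_bicommutant_mult sa_bicommutant_scaleR)
  have "norm q1 \<le> norm (exp y) * norm p1" unfolding q1_def by (rule norm_mult_ineq)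
  also have "\<dots> \<le> exp r * exp (2 * r)"
    using norm_exp[of y] ny p1(3) nz(1) by (intro mult_mono) (auto intro: order_trans)
  finally have nq1: "norm q1 \<le> exp (3 * r)" by (simp flip: exp_add)
  have "norm q2 \<le> exp (- r) * exp (2 * r)"
    unfolding q2_def using p2(3) nz(2) by (auto intro: order_trans)
  also have "\<dots> \<le> exp (3 * r)" using r by (simp flip: exp_add)
  finally have nq2: "norm q2 \<le> exp (3 * r)" .
  have e1: "z1 * q1 = exp r *\<^sub>R 1 - exp y"
  proof -
    have "z1 * q1 = exp y * (z1 * p1)"
      unfolding q1_def using cm[OF z1D eyD] by (metis mult.assoc)
    also have "\<dots> = exp y * exp z1 - exp y" by (simp add: p1 algebra_simps)
    also have "exp y * exp z1 = exp (y + z1)"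
      by (rule exp_add_commuting[symmetric]) (rule cm[OF yD z1D])
    also have "y + z1 = r *\<^sub>R 1" by (simp add: z1_def)
    finally show ?thesis by (simp add: exp_scaleR_one)
  qed
  have e2: "z2 * q2 = exp y - exp (- r) *\<^sub>R 1"
  proof -
    have "z2 * q2 = exp (- r) *\<^sub>R exp z2 - exp (- r) *\<^sub>R 1"
      by (simp add: q2_def p2 algebra_simps)
    also have "exp z2 = exp r *\<^sub>R exp y"
      unfolding z2_def by (subst exp_add_commuting) (simp_all add: exp_scaleR_one)
    finally show ?thesis by (simp flip: exp_add)
  qed
  have chsh: "\<kappa> * exp r = \<kappa> * cosh r + \<kappa> * sinh r" "\<kappa> * exp (- r) = \<kappa> * cosh r - \<kappa> * sinh r"
    by (metis cosh_plus_sinh distrib_left) (metis cosh_minus_sinh right_diff_distrib)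
  define n1 where "n1 = (\<kappa> / K) *\<^sub>R q1"
  define n2 where "n2 = (\<kappa> / K) *\<^sub>R q2"
  have nD: "n1 \<in> ?D" "n2 \<in> ?D" unfolding n1_def n2_def using qD by (intro D_intros; simp)+
  have nn: "norm n1 \<le> 1" "norm n2 \<le> 1"
  proof -
    have "\<kappa> * norm q \<le> K" if "norm q \<le> exp (3 * r)" for q :: 'a
      using that k K by (smt (verit) mult_left_mono)
    then show "norm n1 \<le> 1" "norm n2 \<le> 1"
      using nq1 nq2 K0 k by (auto simp: n1_def n2_def)
  qed
  have BmF: "B *\<^sub>R 1 - F = K *\<^sub>R (z1 * (1 - n1))"
  proof -
    have "K *\<^sub>R (z1 * (1 - n1)) = K *\<^sub>R z1 - \<kappa> *\<^sub>R (z1 * q1)"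
      using K0 by (simp add: n1_def algebra_simps)
    also have "\<dots> = (K * r) *\<^sub>R 1 - K *\<^sub>R y - (\<kappa> * exp r) *\<^sub>R 1 + \<kappa> *\<^sub>R exp y"
      unfolding e1 by (simp add: z1_def algebra_simps)
    finally show ?thesis unfolding chsh B_def F_def by (simp add: algebra_simps)
  qed
  have BpF: "B *\<^sub>R 1 + F = K *\<^sub>R (z2 * (1 - n2))"
  proof -
    have "K *\<^sub>R (z2 * (1 - n2)) = K *\<^sub>R z2 - \<kappa> *\<^sub>R (z2 * q2)"
      using K0 by (simp add: n2_def algebra_simps)
    also have "\<dots> = (K * r) *\<^sub>R 1 + K *\<^sub>R y + (\<kappa> * exp (- r)) *\<^sub>R 1 - \<kappa> *\<^sub>R exp y"
      unfolding e2 by (simp add: z2_def algebra_simps)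
    finally show ?thesis unfolding chsh B_def F_def by (simp add: algebra_simps)
  qed
  obtain s1 where s1: "s1 \<in> ?D" "s1 * s1 = 1 - n1" using exists_sqrt[OF nD(1) nn(1)] by blast
  obtain s2 where s2: "s2 \<in> ?D" "s2 * s2 = 1 - n2" using exists_sqrt[OF nD(2) nn(2)] by blast
  have "norm ((1 / r) *\<^sub>R y) \<le> 1" using ny r by simp
  then have "norm (((1 / r) *\<^sub>R y) * ((1 / r) *\<^sub>R y)) \<le> 1"
    by (meson mult_le_one norm_ge_zero norm_mult_ineq order_trans)
  moreover have "((1 / r) *\<^sub>R y) * ((1 / r) *\<^sub>R y) \<in> ?D" using yD by (intro D_intros)
  ultimately obtain s3 where s3: "s3 \<in> ?D" "s3 * s3 = 1 - ((1 / r) *\<^sub>R y) * ((1 / r) *\<^sub>R y)"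
    using exists_sqrt by blast
  define z where "z = (K * r) *\<^sub>R (s3 * (s1 * s2))"
  have s12D: "s1 * s2 \<in> ?D" using s1(1) s2(1) by (rule sa_bicommutant_mult)
  have zD: "z \<in> ?D" unfolding z_def using s12D s3(1) by (auto intro: sa_bicommutant_mult sa_bicommutant_scaleR)
  have "z * z = (K * r)\<^sup>2 *\<^sub>R ((s3 * (s1 * s2)) * (s3 * (s1 * s2)))"
    by (simp add: z_def power2_eq_square)
  also have "(s3 * (s1 * s2)) * (s3 * (s1 * s2)) = (s3 * s3) * ((s1 * s2) * (s1 * s2))"
    using cm[OF s12D s3(1)] by (metis mult.assoc)
  also have "(s1 * s2) * (s1 * s2) = (s1 * s1) * (s2 * s2)"
    using cm[OF s1(1) s2(1)] by (metis mult.assoc)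
  also have "(K * r)\<^sup>2 *\<^sub>R ((s3 * s3) * ((s1 * s1) * (s2 * s2))) = (K\<^sup>2) *\<^sub>R ((r\<^sup>2 *\<^sub>R (s3 * s3)) * ((1 - n1) * (1 - n2)))"
    unfolding s1 s2 by (simp add: power_mult_distrib)
  also have "r\<^sup>2 *\<^sub>R (s3 * s3) = z1 * z2"
    unfolding s3 z1_def z2_def using r by (simp add: algebra_simps power2_eq_square)
  also have "(K\<^sup>2) *\<^sub>R ((z1 * z2) * ((1 - n1) * (1 - n2))) = (K *\<^sub>R (z1 * (1 - n1))) * (K *\<^sub>R (z2 * (1 - n2)))"
  proof -
    have "1 - n1 \<in> ?D" using nD by (intro D_intros)
    then have "z2 * (1 - n1) = (1 - n1) * z2" using cm z2D by blast
    then show ?thesis by (simp add: power2_eq_square) (metis mult.assoc)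
  qed
  also have "\<dots> = (B *\<^sub>R 1 - F) * (B *\<^sub>R 1 + F)" by (simp add: BmF BpF)
  also have "\<dots> = (B\<^sup>2) *\<^sub>R 1 - F * F" by (simp add: algebra_simps power2_eq_square)
  finally have zz: "F * F + z * z = (B\<^sup>2) *\<^sub>R 1" by simp
  have "\<kappa> * sinh r \<le> K * r"
  proof -
    have "exp (r * (- 2)) \<ge> 1 + r * (- 2)" by (rule exp_ge_add_one_self)
    then have "exp r * exp (- 2 * r) \<ge> exp r * (1 - 2 * r)" by (intro mult_left_mono) (auto simp: mult.commute)
    then have "exp (- r) \<ge> exp r * (1 - 2 * r)" by (simp flip: exp_add)
    then have "sinh r \<le> exp r * r" by (simp add: sinh_field_def algebra_simps)
    also have "\<dots> \<le> exp (3 * r) * r" using r by simp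
    finally have "\<kappa> * sinh r \<le> \<kappa> * (exp (3 * r) * r)" using k by simp
    also have "\<dots> \<le> K * r" using K r by (simp add: mult.assoc[symmetric])
    finally show ?thesis .
  qed
  then have "B \<ge> 0" by (simp add: B_def)
  then have "norm F \<le> B"
    using zz FD zD by (intro norm_le_if_squares_sum[where z=z]) (auto simp: sa_bicommutant_star intro: cm)
  then show ?thesis by (simp add: F_def B_def)
qed

section \<open>The exponential in the norm of a trace\<close>

text \<open>The functional stands for the real part of a trace. It is given on a subalgebra only, which is closed
  under the exponential but in general not under square roots.\<close>

locale tracial_subalgebra =
  fixes S :: "'a::cstar_algebra set" and tr :: "'a \<Rightarrow> real"
  assumes one: "1 \<in> S"
    and add: "x \<in> S \<Longrightarrow> y \<in> S \<Longrightarrow> x + y \<in> S"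
    and scaleR: "x \<in> S \<Longrightarrow> c *\<^sub>R x \<in> S"
    and mult: "x \<in> S \<Longrightarrow> y \<in> S \<Longrightarrow> x * y \<in> S"
    and star: "x \<in> S \<Longrightarrow> star x \<in> S"
    and exp: "x \<in> S \<Longrightarrow> exp x \<in> S"
    and tr_add: "x \<in> S \<Longrightarrow> y \<in> S \<Longrightarrow> tr (x + y) = tr x + tr y"
    and tr_scaleR: "x \<in> S \<Longrightarrow> tr (c *\<^sub>R x) = c * tr x"
    and tr_bound: "x \<in> S \<Longrightarrow> \<bar>tr x\<bar> \<le> norm x"
    and tr_commute: "x \<in> S \<Longrightarrow> y \<in> S \<Longrightarrow> tr (x * y) = tr (y * x)"
    and tr_star: "x \<in> S \<Longrightarrow> tr (star x) = tr x"
    and tr_pos: "x \<in> S \<Longrightarrow> tr (star x * x) \<ge> 0"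
begin

lemma minus: "x \<in> S \<Longrightarrow> - x \<in> S"
  using scaleR[of x "-1"] by simp

lemma diff: "x \<in> S \<Longrightarrow> y \<in> S \<Longrightarrow> x - y \<in> S"
  using add[of x "- y"] minus by simp

lemma power: "x \<in> S \<Longrightarrow> x ^ n \<in> S"
  by (induction n) (auto simp: one mult)

lemmas closed = one add scaleR mult star exp minus diff power

lemma tr_minus: "x \<in> S \<Longrightarrow> tr (- x) = - tr x"
  using tr_scaleR[of x "-1"] by simp

lemma tr_diff: "x \<in> S \<Longrightarrow> y \<in> S \<Longrightarrow> tr (x - y) = tr x - tr y"
  using tr_add[of x "- y"] tr_minus minus by simp

text \<open>The Hilbert-Schmidt norm, that is, the norm of the GNS space of the trace.\<close>

definition norm2 :: "'a \<Rightarrow> real" where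
  "norm2 x = sqrt (tr (star x * x))"

lemma norm2_sq: "x \<in> S \<Longrightarrow> (norm2 x)\<^sup>2 = tr (star x * x)"
  unfolding norm2_def by (simp add: tr_pos)

lemma norm2_nonneg: "x \<in> S \<Longrightarrow> norm2 x \<ge> 0"
  unfolding norm2_def by (simp add: tr_pos)

lemma norm2_star: "x \<in> S \<Longrightarrow> norm2 (star x) = norm2 x"
  unfolding norm2_def by (simp add: star_star tr_commute star)

lemma tr_star_mult_commute:
  assumes "x \<in> S" "y \<in> S" shows "tr (star y * x) = tr (star x * y)"
  using tr_star[of "star x * y"] assms by (simp add: closed star_mult star_star)

lemma norm2_lincomb_sq:
  assumes "x \<in> S" "y \<in> S"
  shows "(norm2 (a *\<^sub>R x - b *\<^sub>R y))\<^sup>2 = a\<^sup>2 * (norm2 x)\<^sup>2 - 2 * a * b * tr (star x * y) + b\<^sup>2 * (norm2 y)\<^sup>2"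
proof -
  have "star (a *\<^sub>R x - b *\<^sub>R y) * (a *\<^sub>R x - b *\<^sub>R y)
      = (a\<^sup>2 *\<^sub>R (star x * x) - (a * b) *\<^sub>R (star x * y)) - ((a * b) *\<^sub>R (star y * x) - b\<^sup>2 *\<^sub>R (star y * y))"
    by (simp add: star_diff star_scaleR algebra_simps power2_eq_square)
  then have "tr (star (a *\<^sub>R x - b *\<^sub>R y) * (a *\<^sub>R x - b *\<^sub>R y))
      = (a\<^sup>2 * tr (star x * x) - (a * b) * tr (star x * y)) - ((a * b) * tr (star y * x) - b\<^sup>2 * tr (star y * y))"
    using assms by (simp add: tr_diff tr_scaleR closed)
  then show ?thesis
    using assms by (simp add: norm2_sq closed tr_star_mult_commute)
qed

lemma cauchy_schwarz:
  assumes "x \<in> S" "y \<in> S"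
  shows "tr (star x * y) \<le> norm2 x * norm2 y"
proof -
  define c where "c = tr (star x * y)"
  \<comment> \<open>the square of the norm of \<open>a x - b y\<close>; the choice \<open>a = 1\<close>, \<open>b = c / (norm2 y)\<^sup>2\<close> minimises it\<close>
  have q: "0 \<le> a\<^sup>2 * (norm2 x)\<^sup>2 - 2 * a * b * c + b\<^sup>2 * (norm2 y)\<^sup>2" for a b
    using norm2_lincomb_sq[OF assms, of a b] by (simp add: c_def) (metis zero_le_power2)
  have "c\<^sup>2 \<le> (norm2 x)\<^sup>2 * (norm2 y)\<^sup>2"
  proof (cases "norm2 y = 0")
    case True
    have "c = 0"
    proof (rule ccontr)
      assume "c \<noteq> 0"
      then show False using q[of 1 "((norm2 x)\<^sup>2 + 1) / (2 * c)"] True by simp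
    qed
    then show ?thesis by simp
  next
    case False
    have "0 \<le> (norm2 x)\<^sup>2 - c\<^sup>2 / (norm2 y)\<^sup>2"
      using q[of 1 "c / (norm2 y)\<^sup>2"] False by (simp add: power_divide power2_eq_square field_simps)
    then show ?thesis using False by (simp add: field_simps)
  qed
  then have "\<bar>c\<bar> \<le> \<bar>norm2 x * norm2 y\<bar>" by (simp add: power_mult_distrib abs_le_square_iff)
  then show ?thesis using norm2_nonneg assms unfolding c_def by (simp add: abs_mult)
qed

text \<open>The usual argument takes a square root of \<open>(norm x)\<^sup>2 - x\<^sup>* x\<close>, which may leave the subalgebra. Instead,
  with \<open>b = x\<^sup>* x\<close>, the Cauchy-Schwarz inequality makes the moments \<open>a n\<close>, which are the traces of
  \<open>y\<^sup>* b\<^sup>n y\<close>, satisfy \<open>(a n)\<^sup>2 \<le> a 0 a (2 n)\<close>. Along powers of two they grow at least like the powers of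
  \<open>a 1 / a 0\<close>, but at most like those of \<open>norm b\<close>.\<close>

lemma norm2_mult_left:
  assumes x: "x \<in> S" and y: "y \<in> S"
  shows "norm2 (x * y) \<le> norm x * norm2 y"
proof -
  define b where "b = star x * x"
  define a where "a n = tr (star y * (b ^ n * y))" for n
  have bS: "b \<in> S" using x by (simp add: b_def closed)
  have sb: "star (b ^ n) = b ^ n" for n
    by (simp add: star_power b_def star_mult star_star)
  have a0: "a 0 = (norm2 y)\<^sup>2" using y by (simp add: a_def norm2_sq)
  have a1: "a 1 = (norm2 (x * y))\<^sup>2"
    using x y by (simp add: a_def norm2_sq closed b_def star_mult mult.assoc)
  have a2: "a (2 * n) = (norm2 (b ^ n * y))\<^sup>2" for n
    using bS y by (simp add: a_def norm2_sq closed star_mult sb mult.assoc mult_2 power_add)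
  have CS: "(a n)\<^sup>2 \<le> a 0 * a (2 * n)" if "a n \<ge> 0" for n
  proof -
    have "a n \<le> norm2 y * norm2 (b ^ n * y)"
      unfolding a_def using cauchy_schwarz[OF y, of "b ^ n * y"] bS y by (simp add: closed)
    then have "(a n)\<^sup>2 \<le> (norm2 y * norm2 (b ^ n * y))\<^sup>2" using that by (intro power_mono)
    then show ?thesis by (simp add: a0 a2 power_mult_distrib)
  qed
  have up: "a n \<le> norm y * norm b ^ n * norm y" for n
  proof -
    have "a n \<le> norm (star y * (b ^ n * y))"
      unfolding a_def using tr_bound[of "star y * (b ^ n * y)"] bS y by (simp add: closed)
    also have "\<dots> \<le> norm (star y) * (norm (b ^ n) * norm y)"
      by (meson mult_left_mono norm_ge_zero norm_mult_ineq order_trans)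
    also have "\<dots> \<le> norm (star y) * (norm b ^ n * norm y)"
      by (intro mult_left_mono mult_right_mono norm_power_ineq) auto
    finally show ?thesis by (simp add: norm_star mult_ac)
  qed
  have "a 1 \<le> norm b * a 0"
  proof (rule ccontr)
    assume *: "\<not> ?thesis"
    have "a 1 \<ge> 0" unfolding a1 by simp
    have a0p: "a 0 > 0"
    proof (rule ccontr)
      assume "\<not> a 0 > 0"
      then have "a 0 = 0" by (simp add: a0)
      then have "a 1 = 0" using CS[of 1] \<open>a 1 \<ge> 0\<close> by simp
      then show False using * \<open>a 0 = 0\<close> by simp
    qed
    define \<rho> where "\<rho> = a 1 / a 0"
    have \<rho>: "\<rho> > norm b" using * a0p by (simp add: \<rho>_def field_simps)
    have \<rho>0: "\<rho> > 0" using \<rho> norm_ge_zero[of b] by linarith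
    have low: "a 0 * \<rho> ^ (2 ^ n) \<le> a (2 ^ n)" for n
    proof (induction n)
      case (Suc n)
      have nn: "a 0 * \<rho> ^ (2 ^ n) \<ge> 0" using \<rho>0 a0p by simp
      have "a 0 * (a 0 * \<rho> ^ (2 ^ Suc n)) = (a 0 * \<rho> ^ (2 ^ n))\<^sup>2"
        by (simp add: power2_eq_square mult_2 power_add)
      also have "\<dots> \<le> (a (2 ^ n))\<^sup>2" using Suc nn by (intro power_mono)
      also have "\<dots> \<le> a 0 * a (2 * 2 ^ n)" using CS nn Suc by force
      finally show ?case using a0p by simp
    qed (use a0p in \<open>simp add: \<rho>_def\<close>)
    have lu: "a 0 * \<rho> ^ (2 ^ n) \<le> (norm y)\<^sup>2 * norm b ^ (2 ^ n)" for n
      using order_trans[OF low[of n] up] by (simp add: power2_eq_square mult_ac)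
    have b0: "norm b > 0"
    proof (rule ccontr)
      assume "\<not> norm b > 0"
      then show False using lu[of 0] a0p \<rho>0 by (simp add: mult_le_0_iff)
    qed
    have bd: "(\<rho> / norm b) ^ (2 ^ n) \<le> (norm y)\<^sup>2 / a 0" for n
      using lu[of n] a0p b0 by (simp add: power_divide field_simps)
    have gt1: "\<rho> / norm b > 1" using \<rho> b0 by simp
    then obtain n where "(norm y)\<^sup>2 / a 0 < (\<rho> / norm b) ^ n" using real_arch_pow by blast
    also have "\<dots> \<le> (\<rho> / norm b) ^ (2 ^ n)"
      using gt1 by (intro power_increasing) (auto simp: less_imp_le less_exp)
    finally show False using bd[of n] by simp
  qed
  then have "(norm2 (x * y))\<^sup>2 \<le> norm b * (norm2 y)\<^sup>2" unfolding a0 a1 .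
  also have "\<dots> = (norm x * norm2 y)\<^sup>2"
    unfolding b_def norm_star_mult_self power_mult_distrib ..
  finally show ?thesis using norm2_nonneg[OF y] by (rule power2_le_imp_le[OF _ mult_nonneg_nonneg[OF norm_ge_zero]])
qed

lemma norm2_mult_right:
  assumes x: "x \<in> S" and y: "y \<in> S"
  shows "norm2 (y * x) \<le> norm x * norm2 y"
  using norm2_mult_left[of "star x" "star y"] norm2_star[of "y * x"] norm2_star[of y] assms
  by (simp add: closed star_mult norm_star)

lemma tr_has_real_derivative:
  assumes f: "(f has_vector_derivative f') (at s)" and S: "\<And>s. f s \<in> S" "f' \<in> S"
  shows "((\<lambda>s. tr (f s)) has_real_derivative tr f') (at s)"
proof -
  have "(\<lambda>h. norm (f (s + h) - f s - h *\<^sub>R f') / norm h) \<midarrow>0\<rightarrow> 0"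
    using f unfolding has_vector_derivative_def has_derivative_at by blast
  moreover have "norm (norm (tr (f (s + h)) - tr (f s) - tr f' * h) / norm h)
      \<le> norm (f (s + h) - f s - h *\<^sub>R f') / norm h" for h
  proof -
    have "\<bar>tr (f (s + h) - f s - h *\<^sub>R f')\<bar> \<le> norm (f (s + h) - f s - h *\<^sub>R f')"
      by (intro tr_bound closed S)
    moreover have "tr (f (s + h) - f s - h *\<^sub>R f') = tr (f (s + h)) - tr (f s) - tr f' * h"
      using S by (simp add: tr_diff tr_scaleR closed)
    ultimately show ?thesis by (simp add: divide_right_mono)
  qed
  ultimately have "(\<lambda>h. norm (tr (f (s + h)) - tr (f s) - tr f' * h) / norm h) \<midarrow>0\<rightarrow> 0"
    using Lim_null_comparison[where f="\<lambda>h. norm (tr (f (s + h)) - tr (f s) - tr f' * h) / norm h"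
        and g="\<lambda>h. norm (f (s + h) - f s - h *\<^sub>R f') / norm h" and net="at 0"]
    by simp
  then show ?thesis
    unfolding has_field_derivative_def has_derivative_at by (simp add: bounded_linear_mult_right)
qed

text \<open>Differentiating \<open>e\<^bsup>s u\<^esup> e\<^bsup>(1-s) v\<^esup>\<close> in \<open>s\<close>: Duhamel's formula under the trace, with the
  integral replaced by an intermediate value.\<close>

lemma tr_exp_diff_mean_value:
  assumes S: "w \<in> S" "u \<in> S" "v \<in> S"
  shows "\<exists>s. 0 < s \<and> s < 1 \<and>
    tr (w * (exp u - exp v)) = tr (w * (exp (s *\<^sub>R u) * (u - v) * exp ((1 - s) *\<^sub>R v)))"
proof -
  define f where "f s = w * (exp (s *\<^sub>R u) * exp (s *\<^sub>R (- v))) * exp v" for s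
  define f' where "f' s = w * (exp (s *\<^sub>R u) * (- v * exp (s *\<^sub>R (- v))) + exp (s *\<^sub>R u) * u * exp (s *\<^sub>R (- v))) * exp v" for s
  have ev: "exp (s *\<^sub>R (- v)) * exp v = exp ((1 - s) *\<^sub>R v)" for s
    by (subst exp_add_commuting[symmetric]) (simp_all add: algebra_simps)
  have f_alt: "f s = w * (exp (s *\<^sub>R u) * exp ((1 - s) *\<^sub>R v))" for s
    unfolding f_def ev[symmetric] by (simp only: mult.assoc)
  have f'_alt: "f' s = w * (exp (s *\<^sub>R u) * (u - v) * exp ((1 - s) *\<^sub>R v))" for s
    unfolding f'_def ev[symmetric] by (simp add: algebra_simps)
  have "(f has_vector_derivative f' s) (at s)" for s
    unfolding f_def f'_def
    by (intro has_vector_derivative_mult_left has_vector_derivative_mult_right has_vector_derivative_mult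
      exp_scaleR_has_vector_derivative_left exp_scaleR_has_vector_derivative_right)
  then have D: "((\<lambda>s. tr (f s)) has_real_derivative tr (f' s)) (at s)" for s
    by (rule tr_has_real_derivative) (use S in \<open>auto simp: f_def f'_def intro!: closed\<close>)
  obtain s :: real where s: "0 < s" "s < 1" "tr (f 1) - tr (f 0) = (1 - 0) * tr (f' s)"
    using MVT2[of 0 1 "\<lambda>s. tr (f s)" "\<lambda>s. tr (f' s)"] D by auto
  moreover have "tr (f 1) - tr (f 0) = tr (w * (exp u - exp v))"
    using S by (simp add: f_alt right_diff_distrib tr_diff closed)
  ultimately show ?thesis unfolding f'_alt by auto
qed

context
  fixes u v :: 'a and r :: real
  assumes uv: "u \<in> S" "v \<in> S" "star u = u" "star v = v" "norm u \<le> r" "norm v \<le> r"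
begin

lemma norm_exp_scaleR_le:
  assumes "norm w \<le> r"
  shows "norm (exp (c *\<^sub>R w)) \<le> exp (\<bar>c\<bar> * r)"
proof -
  have "norm (exp (c *\<^sub>R w)) \<le> exp (norm (c *\<^sub>R w))" by (rule norm_exp)
  also have "\<dots> \<le> exp (\<bar>c\<bar> * r)" using assms by (simp add: mult_left_mono)
  finally show ?thesis .
qed

text \<open>After splitting both exponentials of the mean value formula into halves \<open>p\<close>, \<open>q\<close>, cyclicity turns the
  trace of \<open>h e\<^bsup>s u\<^esup> h e\<^bsup>(1-s) v\<^esup>\<close> with \<open>h = u - v\<close> into the square of the norm of \<open>p h q\<close>. Multiplying by the inverses of \<open>p\<close>
  and \<open>q\<close>, whose norms multiply to at most \<open>e\<^bsup>r/2\<^esup>\<close>, recovers \<open>h\<close>.\<close>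

lemma exp_strongly_monotone:
  "tr ((u - v) * (exp u - exp v)) \<ge> exp (- r) * (norm2 (u - v))\<^sup>2"
proof -
  define h where "h = u - v"
  have hS: "h \<in> S" and sh: "star h = h" using uv by (simp_all add: h_def closed star_diff)
  obtain s where s: "0 < s" "s < 1"
    "tr (h * (exp u - exp v)) = tr (h * (exp (s *\<^sub>R u) * h * exp ((1 - s) *\<^sub>R v)))"
    using tr_exp_diff_mean_value[OF hS uv(1,2)] unfolding h_def by blast
  define p where "p c = exp (c *\<^sub>R u)" for c
  define q where "q c = exp (c *\<^sub>R v)" for c
  have pq: "p c \<in> S" "q c \<in> S" "star (p c) = p c" "star (q c) = q c" for c
    using uv by (simp_all add: p_def q_def closed star_exp star_scaleR)
  have pp: "p c * p d = p (c + d)" "q c * q d = q (c + d)" for c d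
    unfolding p_def q_def by (subst exp_add_commuting[symmetric]; simp add: scaleR_left_distrib)+
  have p0: "p 0 = 1" "q 0 = 1" by (simp_all add: p_def q_def)
  define k where "k = p (s/2) * h * q ((1 - s)/2)"
  have kS: "k \<in> S" using pq hS by (simp add: k_def closed)
  have "tr (h * (p s * h * q (1 - s))) = tr ((h * p s * h * q ((1 - s)/2)) * q ((1 - s)/2))"
    using pp(2)[of "(1-s)/2" "(1-s)/2"] by (simp add: mult.assoc)
  also have "\<dots> = tr (q ((1 - s)/2) * (h * p s * h * q ((1 - s)/2)))"
    using pq hS by (intro tr_commute closed)
  also have "q ((1 - s)/2) * (h * p s * h * q ((1 - s)/2)) = star k * k"
    using arg_cong[OF pp(1)[of "s/2" "s/2"], of "\<lambda>x. x * z" for z]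
    by (simp add: k_def star_mult pq sh mult.assoc)
  also have "tr (star k * k) = (norm2 k)\<^sup>2" using kS by (simp add: norm2_sq)
  finally have tk: "tr (h * (exp u - exp v)) = (norm2 k)\<^sup>2"
    using s(3) by (simp add: p_def q_def)
  have "h = p (- s/2) * (k * q (- (1 - s)/2))"
  proof -
    have "p (- s/2) * (k * q (- (1 - s)/2)) = (p (- s/2) * p (s/2)) * h * (q ((1 - s)/2) * q (- (1 - s)/2))"
      by (simp add: k_def mult.assoc)
    then show ?thesis unfolding pp by (simp add: p0 flip: add_divide_distrib)
  qed
  then have "norm2 h \<le> norm (p (- s/2)) * norm2 (k * q (- (1 - s)/2))"
    using norm2_mult_left[of "p (- s/2)" "k * q (- (1 - s)/2)"] pq kS by (simp add: closed)
  also have "\<dots> \<le> norm (p (- s/2)) * (norm (q (- (1 - s)/2)) * norm2 k)"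
    using pq kS by (intro mult_left_mono norm2_mult_right) auto
  also have "\<dots> \<le> exp (s/2 * r) * (exp ((1 - s)/2 * r) * norm2 k)"
    using norm_exp_scaleR_le[OF uv(5), of "- s/2"] norm_exp_scaleR_le[OF uv(6), of "- (1 - s)/2"] s kS
    unfolding p_def q_def by (intro mult_mono) (auto simp: norm2_nonneg)
  also have "\<dots> = exp (r/2) * norm2 k"
    by (simp flip: exp_add mult.assoc) (simp add: algebra_simps diff_divide_distrib)
  finally have "(norm2 h)\<^sup>2 \<le> (exp (r/2) * norm2 k)\<^sup>2"
    using norm2_nonneg[OF hS] by (intro power_mono)
  also have "\<dots> = exp r * (norm2 k)\<^sup>2" by (simp add: power_mult_distrib flip: exp_double)
  finally have "exp (- r) * (norm2 h)\<^sup>2 \<le> exp (- r) * (exp r * (norm2 k)\<^sup>2)"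
    by (intro mult_left_mono) auto
  then show ?thesis using tk by (simp add: h_def flip: mult.assoc exp_add)
qed

lemma norm2_exp_diff_le: "norm2 (exp u - exp v) \<le> exp r * norm2 (u - v)"
proof (cases "norm2 (exp u - exp v) = 0")
  case True
  then show ?thesis using uv by (simp add: norm2_nonneg closed)
next
  case False
  define w where "w = exp u - exp v"
  define h where "h = u - v"
  have S: "w \<in> S" "h \<in> S" using uv by (simp_all add: w_def h_def closed)
  obtain s where s: "0 < s" "s < 1"
    "tr (star w * w) = tr (star w * (exp (s *\<^sub>R u) * h * exp ((1 - s) *\<^sub>R v)))"
    using tr_exp_diff_mean_value[of "star w" u v] S uv unfolding h_def w_def by (auto simp: closed)
  have "(norm2 w)\<^sup>2 \<le> norm2 w * norm2 (exp (s *\<^sub>R u) * h * exp ((1 - s) *\<^sub>R v))"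
    unfolding norm2_sq[OF S(1)] s(3) using S uv by (intro cauchy_schwarz) (auto intro!: closed)
  then have "norm2 w \<le> norm2 (exp (s *\<^sub>R u) * h * exp ((1 - s) *\<^sub>R v))"
    using False norm2_nonneg[OF S(1)] by (simp add: power2_eq_square w_def)
  also have "\<dots> \<le> norm (exp ((1 - s) *\<^sub>R v)) * norm2 (exp (s *\<^sub>R u) * h)"
    using S uv by (intro norm2_mult_right) (auto intro!: closed)
  also have "\<dots> \<le> norm (exp ((1 - s) *\<^sub>R v)) * (norm (exp (s *\<^sub>R u)) * norm2 h)"
    using S uv by (intro mult_left_mono norm2_mult_left) (auto intro!: closed)
  also have "\<dots> \<le> exp ((1 - s) * r) * (exp (s * r) * norm2 h)"
    using norm_exp_scaleR_le[OF uv(5), of s] norm_exp_scaleR_le[OF uv(6), of "1 - s"] s S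
    by (intro mult_mono) (auto simp: norm2_nonneg)
  also have "\<dots> = exp r * norm2 h"
    by (simp flip: exp_add mult.assoc) (simp add: algebra_simps)
  finally show ?thesis by (simp add: w_def h_def)
qed

text \<open>Strong monotonicity and the Lipschitz bound make \<open>u \<mapsto> K u - \<kappa> e\<^sup>u\<close> Lipschitz in the
  trace norm with a constant strictly below \<open>K\<close>.\<close>

lemma norm2_exp_perturbation_le:
  assumes k: "\<kappa> > 0" and K: "K \<ge> \<kappa> * exp (3 * r)"
  shows "(norm2 (K *\<^sub>R (u - v) - \<kappa> *\<^sub>R (exp u - exp v)))\<^sup>2 \<le> (K\<^sup>2 - K * \<kappa> * exp (- r)) * (norm2 (u - v))\<^sup>2"
proof -
  define h where "h = u - v"
  define w where "w = exp u - exp v"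
  have S: "w \<in> S" "h \<in> S" and sh: "star h = h"
    using uv by (simp_all add: w_def h_def closed star_diff)
  have K0: "K > 0" using k K by (smt (verit) exp_gt_zero mult_pos_pos)
  have "(norm2 (K *\<^sub>R h - \<kappa> *\<^sub>R w))\<^sup>2 = K\<^sup>2 * (norm2 h)\<^sup>2 - 2 * K * \<kappa> * tr (h * w) + \<kappa>\<^sup>2 * (norm2 w)\<^sup>2"
    using norm2_lincomb_sq[OF S(2,1)] sh by simp
  also have "\<dots> \<le> K\<^sup>2 * (norm2 h)\<^sup>2 - 2 * K * \<kappa> * (exp (- r) * (norm2 h)\<^sup>2) + \<kappa>\<^sup>2 * (exp r * norm2 h)\<^sup>2"
  proof -
    have "2 * K * \<kappa> * (exp (- r) * (norm2 h)\<^sup>2) \<le> 2 * K * \<kappa> * tr (h * w)"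
      using exp_strongly_monotone K0 k by (intro mult_left_mono) (auto simp: h_def w_def)
    moreover have "\<kappa>\<^sup>2 * (norm2 w)\<^sup>2 \<le> \<kappa>\<^sup>2 * (exp r * norm2 h)\<^sup>2"
      using norm2_exp_diff_le norm2_nonneg[OF S(1)] by (intro mult_left_mono power_mono) (auto simp: h_def w_def)
    ultimately show ?thesis by linarith
  qed
  also have "\<kappa>\<^sup>2 * (exp r * norm2 h)\<^sup>2 = \<kappa> * exp (- r) * (\<kappa> * exp (3 * r)) * (norm2 h)\<^sup>2"
  proof -
    have "(exp r)\<^sup>2 = exp (- r) * exp (3 * r)" by (simp flip: exp_add exp_double)
    then show ?thesis by (simp add: power_mult_distrib power2_eq_square)
  qed
  also have "\<dots> \<le> \<kappa> * exp (- r) * K * (norm2 h)\<^sup>2"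
    using K k by (intro mult_right_mono mult_left_mono) auto
  finally show ?thesis by (simp add: h_def w_def algebra_simps)
qed

end

end

section \<open>Unitaries and weighted sums over the integer grid\<close>

lemma unitary_norm: "unitary u \<Longrightarrow> norm (u::'a::cstar_algebra) = 1"
  using norm_star_mult_self[of u] by (simp add: unitary_def power2_eq_1_iff) (smt (verit) norm_ge_zero)

lemma unitary_mult: "unitary u \<Longrightarrow> unitary v \<Longrightarrow> unitary (u * v :: 'a::cstar_algebra)"
proof -
  assume u: "unitary u" and v: "unitary v"
  have "star (u * v) * (u * v) = star v * (star u * u) * v" "u * v * star (u * v) = u * (v * star v) * star u"
    by (simp_all add: star_mult mult.assoc)
  then show "unitary (u * v)" using u v by (simp add: unitary_def)
qed

lemma norm_unitary_conj_le: "unitary u \<Longrightarrow> norm (u * x * star u) \<le> norm (x::'a::cstar_algebra)"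
  using norm_mult_ineq[of "u * x" "star u"] norm_mult_ineq[of u x] by (simp add: norm_star unitary_norm)

lemma upow_0 [simp]: "upow u 0 = 1"
  by (simp add: upow_def)

lemma upow_plus_one:
  assumes "unitary (u::'a::cstar_algebra)"
  shows "upow u (k + 1) = upow u k * u"
proof (cases "k \<ge> 0")
  case True
  then show ?thesis by (simp add: upow_def nat_add_distrib power_commutes)
next
  case False
  then have "nat (- k) = Suc (nat (- (k + 1)))" by linarith
  then have "upow u k * u = star u ^ nat (- (k + 1)) * (star u * u)"
    using False by (simp add: upow_def power_Suc2 mult.assoc del: power_Suc)
  then show ?thesis using False assms by (auto simp: upow_def unitary_def)
qed

lemma upow_minus_one:
  assumes "unitary (u::'a::cstar_algebra)"
  shows "upow u (k - 1) = upow u k * star u"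
  using upow_plus_one[OF assms, of "k - 1"] assms by (simp add: unitary_def mult.assoc)

lemma upow_add:
  assumes "unitary (u::'a::cstar_algebra)"
  shows "upow u (j + k) = upow u j * upow u k"
proof (induction k rule: int_induct[where k=0])
  case (step1 i)
  then show ?case using upow_plus_one[OF assms] by (metis add.assoc mult.assoc)
next
  case (step2 i)
  then show ?case using upow_minus_one[OF assms] by (metis add_diff_eq mult.assoc)
qed simp

lemma star_upow: "star (upow u k) = upow (u::'a::cstar_algebra) (- k)"
  by (auto simp: upow_def star_power star_star)

lemma unitary_upow:
  assumes "unitary (u::'a::cstar_algebra)"
  shows "unitary (upow u k)"
  unfolding unitary_def star_upow by (simp flip: upow_add[OF assms])

type_synonym grid = "int \<times> int"

text \<open>Submultiplicativity of this weight makes the weighted \<open>\<ell>\<^sup>1\<close> spaces into algebras.\<close>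

definition weight :: "grid \<Rightarrow> real" where
  "weight k = 1 + \<bar>real_of_int (fst k)\<bar> + \<bar>real_of_int (snd k)\<bar>"

lemma weight_ge_1: "weight k \<ge> 1"
  by (simp add: weight_def)

lemma weight_pos [simp]: "weight k > 0" "weight k \<ge> 0" "weight k \<noteq> 0"
  using weight_ge_1[of k] by linarith+

lemma weight_minus [simp]: "weight (- k) = weight k"
  by (simp add: weight_def)

lemma weight_0 [simp]: "weight 0 = 1"
  by (simp add: weight_def)

lemma weight_add_le: "weight (j + k) \<le> weight j * weight k"
proof -
  have "weight (j + k) \<le> weight j + weight k - 1"
    by (simp add: weight_def)
  also have "\<dots> \<le> weight j * weight k"
    using mult_nonneg_nonneg[of "weight j - 1" "weight k - 1"] weight_ge_1 by (simp add: algebra_simps)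
  finally show ?thesis .
qed

definition weight_summable :: "nat \<Rightarrow> (grid \<Rightarrow> complex) \<Rightarrow> bool" where
  "weight_summable s c \<longleftrightarrow> (\<lambda>k. weight k ^ s * cmod (c k)) summable_on UNIV"

definition weight_norm :: "nat \<Rightarrow> (grid \<Rightarrow> complex) \<Rightarrow> real" where
  "weight_norm s c = (\<Sum>\<^sub>\<infinity>k. weight k ^ s * cmod (c k))"

lemma weight_summable_comparison:
  assumes "weight_summable s d" "\<And>k. weight k ^ s' * cmod (c k) \<le> B * (weight k ^ s * cmod (d k))"
  shows "weight_summable s' c"
  unfolding weight_summable_def
  by (rule summable_on_comparison_test[OF summable_on_cmult_right[OF assms(1)[unfolded weight_summable_def], of B]])
     (use assms(2) in auto)

lemma weight_summable_mono:
  assumes "weight_summable s c" "s' \<le> s"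
  shows "weight_summable s' c"
  by (rule weight_summable_comparison[OF assms(1), where B=1])
     (use assms weight_ge_1 in \<open>auto intro!: mult_right_mono power_increasing\<close>)

lemma weight_summable_0: "weight_summable s c \<Longrightarrow> weight_summable 0 c"
  using weight_summable_mono by blast

lemma weight_norm_nonneg: "weight_norm s c \<ge> 0"
  unfolding weight_norm_def by (intro infsum_nonneg) auto

lemma weight_summable_add:
  assumes "weight_summable s c" "weight_summable s d" shows "weight_summable s (\<lambda>k. c k + d k)"
  unfolding weight_summable_def
  by (rule summable_on_comparison_test[OF summable_on_add[OF assms[unfolded weight_summable_def]]])
     (auto simp: norm_triangle_ineq mult_left_mono simp flip: distrib_left)

lemma weight_norm_add_le:
  assumes "weight_summable s c" "weight_summable s d" shows "weight_norm s (\<lambda>k. c k + d k) \<le> weight_norm s c + weight_norm s d"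
  unfolding weight_norm_def infsum_add[OF assms[unfolded weight_summable_def], symmetric]
  using weight_summable_add[OF assms] assms
  by (intro infsum_mono summable_on_add)
     (auto simp: weight_summable_def norm_triangle_ineq mult_left_mono simp flip: distrib_left)

lemma weight_summable_cmult:
  assumes "weight_summable s c" shows "weight_summable s (\<lambda>k. z * c k)"
  by (rule weight_summable_comparison[OF assms, where B="cmod z"]) (simp add: norm_mult mult_ac)

lemma weight_norm_cmult: "weight_norm s (\<lambda>k. z * c k) = cmod z * weight_norm s c"
  unfolding weight_norm_def infsum_cmult_right'[symmetric] by (simp add: norm_mult mult_ac)

lemma weight_summable_diff:
  assumes "weight_summable s c" "weight_summable s d" shows "weight_summable s (\<lambda>k. c k - d k)"
  using weight_summable_add[OF assms(1) weight_summable_cmult[OF assms(2), of "-1"]] by simp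

lemma weight_summable_finite: "finite {k. c k \<noteq> 0} \<Longrightarrow> weight_summable s c"
  unfolding weight_summable_def by (rule finite_nonzero_values_imp_summable_on) (auto elim: finite_subset[rotated])

definition phase :: "real \<Rightarrow> int \<Rightarrow> complex" where
  "phase \<theta> n = cis (2 * pi * \<theta> * of_int n)"

lemma phase_add: "phase \<theta> (m + n) = phase \<theta> m * phase \<theta> n"
  by (simp add: phase_def cis_mult algebra_simps)

lemma phase_0 [simp]: "phase \<theta> 0 = 1"
  by (simp add: phase_def)

lemma norm_phase [simp]: "cmod (phase \<theta> n) = 1"
  by (simp add: phase_def)

lemma cnj_phase: "cnj (phase \<theta> n) = phase \<theta> (- n)"
  by (simp add: phase_def cis_cnj)

lemma phase_power: "phase \<theta> n ^ m = phase \<theta> (int m * n)"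
  proof -
  have "phase \<theta> n ^ m = cis (real m * (2 * pi * \<theta> * of_int n))"
    unfolding phase_def by (rule Complex.DeMoivre)
  also have "\<dots> = phase \<theta> (int m * n)"
    unfolding phase_def by (rule arg_cong[where f=cis]) simp
  finally show ?thesis .
qed

lemma phase_neq_1:
  assumes "\<theta> \<notin> \<rat>" "n \<noteq> 0"
  shows "phase \<theta> n \<noteq> 1"
proof
  assume "phase \<theta> n = 1"
  then have "cos (2 * pi * \<theta> * of_int n) = 1" by (simp add: phase_def complex_eq_iff)
  then obtain m :: int where "2 * pi * \<theta> * of_int n = of_int m * 2 * pi"
    using cos_one_2pi_int by blast
  then have "\<theta> = of_int m / of_int n" using assms(2) by (simp add: field_simps)
  then show False using assms(1) by auto
qed

text \<open>Induction over the integers in both directions; the step down rewrites the hypothesis with the inverse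
  of \<open>u\<close>, which carries the conjugate phase.\<close>

lemma phase_commute_upow:
  fixes u x :: "'a::cstar_algebra"
  assumes u: "unitary u" and c: "x * u = phase \<theta> j *\<^sub>C (u * x)"
  shows "x * upow u k = phase \<theta> (j * k) *\<^sub>C (upow u k * x)"
proof (induction k rule: int_induct[where k=0])
  case (step1 i)
  have "x * upow u (i + 1) = phase \<theta> (j * i) *\<^sub>C (upow u i * (x * u))"
    by (simp add: upow_plus_one[OF u] step1 scaleC_mult_left flip: mult.assoc)
  also have "\<dots> = phase \<theta> (j * (i + 1)) *\<^sub>C (upow u (i + 1) * x)"
    by (simp add: c scaleC_mult_right scaleC_scaleC upow_plus_one[OF u] distrib_left flip: phase_add mult.assoc)
  finally show ?case .
next
  case (step2 i)
  have "star u * (x * u) * star u = phase \<theta> j *\<^sub>C (star u * (u * x) * star u)"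
    by (simp add: c scaleC_mult_right scaleC_mult_left)
  moreover have "star u * (x * u) * star u = star u * x" "star u * (u * x) * star u = x * star u"
    using u unfolding unitary_def by (metis mult.assoc mult_1_left mult_1_right)+
  ultimately have "star u * x = phase \<theta> j *\<^sub>C (x * star u)" by simp
  then have c': "x * star u = phase \<theta> (- j) *\<^sub>C (star u * x)"
    by (simp add: scaleC_scaleC flip: phase_add)
  have "x * upow u (i - 1) = phase \<theta> (j * i) *\<^sub>C (upow u i * (x * star u))"
    by (simp add: upow_minus_one[OF u] step2 scaleC_mult_left flip: mult.assoc)
  also have "\<dots> = phase \<theta> (j * (i - 1)) *\<^sub>C (upow u (i - 1) * x)"
    by (simp add: c' scaleC_mult_right scaleC_scaleC upow_minus_one[OF u] right_diff_distrib flip: phase_add mult.assoc)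
  finally show ?case .
qed simp

section \<open>The symbol of the Laplacian\<close>

lemma second_difference_cos_tendsto:
  fixes \<epsilon> :: "nat \<Rightarrow> real"
  assumes "\<And>i. \<epsilon> i \<noteq> 0" "\<epsilon> \<longlonglongrightarrow> 0"
  shows "(\<lambda>i. (2 - 2 * cos (a * \<epsilon> i)) / (\<epsilon> i)\<^sup>2) \<longlonglongrightarrow> a\<^sup>2"
proof -
  have "((\<lambda>x. sin (a / 2 * x)) has_real_derivative cos (a / 2 * 0) * (a / 2)) (at 0)"
    by (auto intro!: derivative_eq_intros)
  then have "(\<lambda>h. sin (a / 2 * h) / h) \<midarrow>0\<rightarrow> a / 2" by (simp add: DERIV_def)
  moreover have "filterlim \<epsilon> (at 0) sequentially"
    unfolding filterlim_at using assms by simp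
  ultimately have "(\<lambda>i. sin (a / 2 * \<epsilon> i) / \<epsilon> i) \<longlonglongrightarrow> a / 2"
    by (rule filterlim_compose)
  then have "(\<lambda>i. (2 * (sin (a / 2 * \<epsilon> i) / \<epsilon> i))\<^sup>2) \<longlonglongrightarrow> (2 * (a / 2))\<^sup>2"
    by (intro tendsto_power tendsto_mult tendsto_const)
  moreover have "(2 * (sin (a / 2 * \<epsilon> i) / \<epsilon> i))\<^sup>2 = (2 - 2 * cos (a * \<epsilon> i)) / (\<epsilon> i)\<^sup>2" for i
    using cos_double_sin[of "a / 2 * \<epsilon> i"] by (simp add: power_mult_distrib power_divide)
  ultimately show ?thesis by simp
qed

text \<open>Positive multiples of \<open>\<theta>\<close> come arbitrarily close to integers, but never equal one, so the differences serve as
  nonzero step sizes.\<close>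

lemma irrational_approximation:
  assumes "\<theta> \<notin> \<rat>"
  obtains j p :: "nat \<Rightarrow> int" where "\<And>i. of_int (j i) * \<theta> - of_int (p i) \<noteq> (0::real)"
    "(\<lambda>i. of_int (j i) * \<theta> - of_int (p i)) \<longlonglongrightarrow> 0"
proof -
  have "\<exists>k h :: int. 0 < k \<and> \<bar>of_int k * \<theta> - of_int h\<bar> < 1 / real (Suc i)" for i
    by (rule Dirichlet_approx[of "Suc i" \<theta>]) auto
  then obtain j p :: "nat \<Rightarrow> int" where jp: "\<And>i. 0 < j i" "\<And>i. \<bar>of_int (j i) * \<theta> - of_int (p i)\<bar> < 1 / real (Suc i)"
    by metis
  show thesis
  proof (rule that)
    show "of_int (j i) * \<theta> - of_int (p i) \<noteq> 0" for i
    proof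
      assume "of_int (j i) * \<theta> - of_int (p i) = 0"
      then have "\<theta> = of_int (p i) / of_int (j i)" using jp(1)[of i] by (simp add: field_simps)
      then show False using assms by auto
    qed
    show "(\<lambda>i. of_int (j i) * \<theta> - of_int (p i)) \<longlonglongrightarrow> 0"
    proof (rule Lim_null_comparison[OF always_eventually[OF allI]])
      show "norm (of_int (j i) * \<theta> - of_int (p i)) \<le> 1 / real (Suc i)" for i
        using jp(2)[of i] by simp
      show "(\<lambda>i. 1 / real (Suc i)) \<longlonglongrightarrow> 0"
        using LIMSEQ_inverse_real_of_nat by (simp add: inverse_eq_divide)
    qed
  qed
qed

lemma inverse_square_summable_int: "(\<lambda>m::int. 1 / (1 + \<bar>real_of_int m\<bar>)\<^sup>2) summable_on UNIV"
proof -
  let ?f = "\<lambda>m::int. 1 / (1 + \<bar>real_of_int m\<bar>)\<^sup>2"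
  have "summable (\<lambda>n::nat. inverse ((real n)\<^sup>2))" by (rule inverse_power_summable) simp
  then have "summable (\<lambda>n. inverse ((real (Suc n))\<^sup>2))" by (subst summable_Suc_iff)
  then have s: "summable (\<lambda>n. 1 / (1 + real n)\<^sup>2)" by (simp add: inverse_eq_divide)
  then have n: "(\<lambda>n::nat. ?f (int n)) summable_on UNIV"
    by (intro summable_nonneg_imp_summable_on) auto
  have "summable (\<lambda>n. 1 / (1 + real (Suc n))\<^sup>2)" using s by (subst summable_Suc_iff)
  then have "(\<lambda>n::nat. ?f (- 1 - int n)) summable_on UNIV"
    by (intro summable_nonneg_imp_summable_on) (auto simp: algebra_simps)
  moreover have "bij_betw (\<lambda>n. - 1 - int n) UNIV {..<0}"
    by (rule bij_betw_byWitness[where f'="\<lambda>m. nat (- 1 - m)"]) auto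
  ultimately have "?f summable_on {..<0}" using summable_on_reindex_bij_betw by blast
  moreover have "bij_betw int UNIV {0..}"
    by (rule bij_betw_byWitness[where f'=nat]) auto
  then have "?f summable_on {0..}" using n summable_on_reindex_bij_betw by blast
  ultimately have "?f summable_on ({..<0} \<union> {0..})" by (intro summable_on_Un_disjoint) auto
  moreover have "{..<0} \<union> {0..} = (UNIV :: int set)" by auto
  ultimately show ?thesis by simp
qed

lemma weight_inverse_summable: "(\<lambda>k. 1 / weight k ^ 4) summable_on UNIV"
proof -
  define f where "f m = 1 / (1 + \<bar>real_of_int m\<bar>)\<^sup>2" for m
  have f: "f summable_on UNIV" unfolding f_def[abs_def] by (rule inverse_square_summable_int)
  have f0: "f m \<ge> 0" for m by (simp add: f_def)
  have "(\<lambda>(m, n). f m * f n) summable_on UNIV \<times> UNIV"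
    by (rule summable_on_SigmaI[where g="\<lambda>m. f m * infsum f UNIV"])
       (use f f0 in \<open>auto intro: has_sum_cmult_right has_sum_infsum summable_on_cmult_left\<close>)
  then have "(\<lambda>k. f (fst k) * f (snd k)) summable_on UNIV" by (simp add: case_prod_unfold)
  then show ?thesis
  proof (rule summable_on_comparison_test)
    fix k :: grid
    have "(1 + \<bar>real_of_int (fst k)\<bar>) * (1 + \<bar>real_of_int (snd k)\<bar>) \<le> weight k * weight k"
      by (intro mult_mono) (auto simp: weight_def)
    then have "((1 + \<bar>real_of_int (fst k)\<bar>) * (1 + \<bar>real_of_int (snd k)\<bar>))\<^sup>2 \<le> (weight k * weight k)\<^sup>2"
      by (intro power_mono) auto
    moreover have "(weight k * weight k)\<^sup>2 = weight k ^ 4" by (simp add: power2_eq_square power4_eq_xxxx)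
    ultimately have "1 / weight k ^ 4 \<le> 1 / ((1 + \<bar>real_of_int (fst k)\<bar>) * (1 + \<bar>real_of_int (snd k)\<bar>))\<^sup>2"
      by (intro divide_left_mono) (auto intro!: mult_pos_pos zero_less_power)
    then show "1 / weight k ^ 4 \<le> f (fst k) * f (snd k)" by (simp add: f_def power_mult_distrib)
  qed auto
qed

definition lap_symbol :: "grid \<Rightarrow> real" where
  "lap_symbol k = (2 * pi * real_of_int (fst k))\<^sup>2 + (2 * pi * real_of_int (snd k))\<^sup>2"

lemma lap_symbol_nonneg [simp]: "lap_symbol k \<ge> 0"
  by (simp add: lap_symbol_def)

lemma lap_symbol_minus [simp]: "lap_symbol (- k) = lap_symbol k"
  by (simp add: lap_symbol_def)

lemma lap_symbol_0 [simp]: "lap_symbol 0 = 0"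
  by (simp add: lap_symbol_def)

text \<open>The resolvent of the Laplacian gains two orders of the weight.\<close>

lemma weight_sq_le:
  assumes "K > 0"
  shows "(weight k)\<^sup>2 \<le> (3 / K + 3) * (K + lap_symbol k)"
proof -
  define m n where "m = \<bar>real_of_int (fst k)\<bar>" and "n = \<bar>real_of_int (snd k)\<bar>"
  have p: "(2 * pi)\<^sup>2 \<ge> 1" using pi_gt3 by (intro one_le_power) simp
  have "(1 + m + n)\<^sup>2 \<le> 3 * (1 + m\<^sup>2 + n\<^sup>2)"
    using sum_squares_bound[of 1 m] sum_squares_bound[of 1 n] sum_squares_bound[of m n]
    by (simp add: power2_eq_square algebra_simps)
  also have "m\<^sup>2 + n\<^sup>2 \<le> lap_symbol k"
    using mult_right_mono[OF p, of "m\<^sup>2 + n\<^sup>2"] by (simp add: lap_symbol_def m_def n_def power_mult_distrib algebra_simps)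
  then have "3 * (1 + m\<^sup>2 + n\<^sup>2) \<le> 3 + 3 * lap_symbol k" by simp
  also have "\<dots> \<le> (3 / K + 3) * (K + lap_symbol k)"
  proof -
    have "(3 / K + 3) * (K + lap_symbol k) = 3 + 3 * lap_symbol k + (3 * K + 3 * lap_symbol k / K)"
      using assms by (simp add: field_simps)
    then show ?thesis using assms by simp
  qed
  finally show ?thesis by (simp add: weight_def m_def n_def)
qed

section \<open>Absolutely convergent expansions\<close>

locale rotation_pair =
  fixes \<theta> :: real and U V :: "'a::cstar_algebra"
  assumes irrational: "\<theta> \<notin> \<rat>" and unitary_U: "unitary U" and unitary_V: "unitary V"
    and rotation: "U * V = cis (2 * pi * \<theta>) *\<^sub>C (V * U)"
begin

text \<open>The monomials form an orthonormal basis for the inner product of the canonical trace.\<close>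

definition e :: "grid \<Rightarrow> 'a" where
  "e k = upow U (fst k) * upow V (snd k)"

definition cocycle :: "grid \<Rightarrow> grid \<Rightarrow> complex" where
  "cocycle j k = phase \<theta> (- (snd j * fst k))"

lemma norm_cocycle [simp]: "cmod (cocycle j k) = 1"
  by (simp add: cocycle_def)

lemma upow_V_U: "upow V n * upow U m = phase \<theta> (- (n * m)) *\<^sub>C (upow U m * upow V n)"
proof -
  have "U * V = phase \<theta> 1 *\<^sub>C (V * U)" by (simp add: phase_def rotation)
  then have "U * upow V n = phase \<theta> n *\<^sub>C (upow V n * U)"
    using phase_commute_upow[OF unitary_V, of U \<theta> 1 n] by simp
  then have "upow V n * U = phase \<theta> (- n) *\<^sub>C (U * upow V n)"
    by (simp add: scaleC_scaleC flip: phase_add)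
  then show ?thesis
    using phase_commute_upow[OF unitary_U, of "upow V n" \<theta> "- n" m] by simp
qed

lemma e_mult: "e j * e k = cocycle j k *\<^sub>C e (j + k)"
proof -
  have "e j * e k = upow U (fst j) * (upow V (snd j) * upow U (fst k)) * upow V (snd k)"
    by (simp add: e_def mult.assoc)
  also have "\<dots> = cocycle j k *\<^sub>C ((upow U (fst j) * upow U (fst k)) * (upow V (snd j) * upow V (snd k)))"
    unfolding upow_V_U cocycle_def by (simp add: scaleC_mult_right scaleC_mult_left mult.assoc)
  finally show ?thesis by (simp add: e_def upow_add[OF unitary_U] upow_add[OF unitary_V])
qed

lemma star_e: "star (e k) = phase \<theta> (- (fst k * snd k)) *\<^sub>C e (- k)"
  by (simp add: e_def star_mult star_upow upow_V_U mult.commute)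

lemma e_0 [simp]: "e 0 = 1"
  by (simp add: e_def)

lemma unitary_e: "unitary (e k)"
  unfolding e_def by (intro unitary_mult unitary_upow unitary_U unitary_V)

lemma norm_e [simp]: "norm (e k) = 1"
  by (simp add: unitary_norm unitary_e)

text \<open>Monomials are eigenvectors of each other's inner automorphisms, with phases that are powers of
  \<open>e\<^bsup>2\<pi>i\<theta>\<^esup>\<close>.\<close>

lemma e_conj: "e j * e k * star (e j) = phase \<theta> (fst j * snd k - snd j * fst k) *\<^sub>C e k"
proof -
  have "e j * e k = cocycle j k *\<^sub>C e (k + j)" unfolding e_mult by (simp only: add.commute)
  also have "e (k + j) = cnj (cocycle k j) *\<^sub>C (e k * e j)"
    by (simp add: e_mult scaleC_scaleC cocycle_def cnj_phase flip: phase_add)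
  finally have "e j * e k = phase \<theta> (fst j * snd k - snd j * fst k) *\<^sub>C (e k * e j)"
    by (simp add: scaleC_scaleC cocycle_def cnj_phase mult.commute flip: phase_add)
  then have "e j * e k * star (e j) = phase \<theta> (fst j * snd k - snd j * fst k) *\<^sub>C (e k * (e j * star (e j)))"
    by (simp add: scaleC_mult_left mult.assoc)
  then show ?thesis using unitary_e[of j] by (simp add: unitary_def)
qed

definition rep :: "(grid \<Rightarrow> complex) \<Rightarrow> 'a" where
  "rep c = (\<Sum>\<^sub>\<infinity>k. c k *\<^sub>C e k)"

lemma rep_abs_summable: "weight_summable 0 c \<Longrightarrow> (\<lambda>k. c k *\<^sub>C e k) abs_summable_on UNIV"
  by (simp add: weight_summable_def norm_scaleC)

lemma rep_has_sum: "weight_summable 0 c \<Longrightarrow> ((\<lambda>k. c k *\<^sub>C e k) has_sum rep c) UNIV"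
  unfolding rep_def by (rule has_sum_infsum[OF abs_summable_summable[OF rep_abs_summable]])

lemma rep_eqI: "((\<lambda>k. c k *\<^sub>C e k) has_sum x) UNIV \<Longrightarrow> rep c = x"
  unfolding rep_def by (rule infsumI)

lemma rep_add: "weight_summable 0 c \<Longrightarrow> weight_summable 0 d \<Longrightarrow> rep (\<lambda>k. c k + d k) = rep c + rep d"
  by (rule rep_eqI) (simp add: scaleC_add_left has_sum_add rep_has_sum)

lemma rep_cmult: "weight_summable 0 c \<Longrightarrow> rep (\<lambda>k. z * c k) = z *\<^sub>C rep c"
  by (rule rep_eqI)
     (use has_sum_bounded_linear[OF bounded_linear_scaleC_right rep_has_sum] in \<open>simp add: scaleC_scaleC\<close>)

lemma rep_diff: "weight_summable 0 c \<Longrightarrow> weight_summable 0 d \<Longrightarrow> rep (\<lambda>k. c k - d k) = rep c - rep d"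
  using rep_add[of c "\<lambda>k. (-1) * d k"] rep_cmult[of d "-1"] weight_summable_cmult[of 0 d "-1"]
  by (simp add: scaleC_minus_left)

lemma rep_finite:
  assumes "finite F" "\<And>k. k \<notin> F \<Longrightarrow> c k = 0"
  shows "rep c = (\<Sum>k\<in>F. c k *\<^sub>C e k)"
  by (rule rep_eqI, rule has_sum_finite_neutralI) (use assms in auto)

text \<open>The coefficients of \<open>e j * x\<close> in terms of those of \<open>x\<close>.\<close>

definition shift :: "grid \<Rightarrow> (grid \<Rightarrow> complex) \<Rightarrow> grid \<Rightarrow> complex" where
  "shift j d = (\<lambda>k. cocycle j (k - j) * d (k - j))"

lemma bij_translate: "bij (\<lambda>k::grid. k - j)"
  by (rule bij_betw_byWitness[where f'="\<lambda>k. k + j"]) auto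

lemma weight_summable_shift:
  assumes "weight_summable s d"
  shows "weight_summable s (shift j d)" "weight_norm s (shift j d) \<le> weight j ^ s * weight_norm s d"
proof -
  define g where "g k = weight j ^ s * (weight k ^ s * cmod (d k))" for k
  have g: "g summable_on UNIV" "infsum g UNIV = weight j ^ s * weight_norm s d"
    using assms unfolding g_def weight_summable_def weight_norm_def
    by (auto intro: summable_on_cmult_right simp: infsum_cmult_right')
  have gs: "(\<lambda>k. g (k - j)) summable_on UNIV" "(\<Sum>\<^sub>\<infinity>k. g (k - j)) = weight j ^ s * weight_norm s d"
    using g summable_on_reindex_bij_betw[OF bij_translate, of g j]
      infsum_reindex_bij_betw[OF bij_translate, of g j] by simp_all
  have le: "weight k ^ s * cmod (shift j d k) \<le> g (k - j)" for k
  proof -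
    have "weight k ^ s \<le> (weight j * weight (k - j)) ^ s"
      using weight_add_le[of j "k - j"] by (intro power_mono) auto
    then show ?thesis
      unfolding shift_def g_def by (simp add: norm_mult power_mult_distrib mult_right_mono flip: mult.assoc)
  qed
  show ws: "weight_summable s (shift j d)" unfolding weight_summable_def
    by (rule summable_on_comparison_test[OF gs(1)]) (use le in auto)
  show "weight_norm s (shift j d) \<le> weight j ^ s * weight_norm s d"
    unfolding gs(2)[symmetric] unfolding weight_norm_def
    by (rule infsum_mono[OF ws[unfolded weight_summable_def] gs(1) le])
qed

lemma e_mult_rep:
  assumes "weight_summable 0 d"
  shows "e j * rep d = rep (shift j d)"
proof -
  have "((\<lambda>k. e j * (d k *\<^sub>C e k)) has_sum (e j * rep d)) UNIV"
    by (rule has_sum_bounded_linear[OF bounded_linear_mult_right rep_has_sum[OF assms]])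
  then have "((\<lambda>k. (d k * cocycle j k) *\<^sub>C e (j + k)) has_sum (e j * rep d)) UNIV"
    by (simp add: scaleC_mult_right e_mult scaleC_scaleC)
  then have "((\<lambda>k. (d (k - j) * cocycle j (k - j)) *\<^sub>C e (j + (k - j))) has_sum (e j * rep d)) UNIV"
    using has_sum_reindex_bij_betw[OF bij_translate, of "\<lambda>k. (d k * cocycle j k) *\<^sub>C e (j + k)" j] by simp
  then show ?thesis
    by (intro rep_eqI[symmetric]) (simp add: shift_def mult.commute)
qed

section \<open>Coefficients are bounded by the norm\<close>

definition mean_factor :: "nat \<Rightarrow> int \<Rightarrow> complex" where
  "mean_factor N n = (\<Sum>j<N. phase \<theta> (int j * n)) / of_nat N"

lemma mean_factor_tendsto: "(\<lambda>N. mean_factor N n) \<longlonglongrightarrow> (if n = 0 then 1 else 0)"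
proof (cases "n = 0")
  case True
  have "eventually (\<lambda>N. mean_factor N n = 1) sequentially"
    using eventually_gt_at_top[of 0] by eventually_elim (simp add: mean_factor_def True)
  then show ?thesis using True by (simp add: tendsto_eventually)
next
  case False
  define z where "z = phase \<theta> n"
  have z: "z \<noteq> 1" "cmod z = 1" using phase_neq_1[OF irrational False] by (simp_all add: z_def)
  have "norm (mean_factor N n) \<le> (2 / cmod (z - 1)) * (1 / real N)" for N
  proof -
    have "mean_factor N n = (\<Sum>j<N. z ^ j) / of_nat N"
      by (simp add: mean_factor_def z_def phase_power)
    also have "\<dots> = (z ^ N - 1) / (z - 1) / of_nat N"
      using z geometric_sum[of z N] by simp
    finally have "norm (mean_factor N n) = cmod (z ^ N - 1) / cmod (z - 1) / real N"
      by (simp add: norm_divide norm_mult)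
    also have "\<dots> \<le> 2 / cmod (z - 1) / real N"
      using norm_triangle_ineq4[of "z ^ N" 1] z by (intro divide_right_mono) (auto simp: norm_power)
    finally show ?thesis by simp
  qed
  moreover have "(\<lambda>N. (2 / cmod (z - 1)) * (1 / real N)) \<longlonglongrightarrow> (2 / cmod (z - 1)) * 0"
    by (intro tendsto_mult tendsto_const lim_1_over_n)
  then have "(\<lambda>N. (2 / cmod (z - 1)) * (1 / real N)) \<longlonglongrightarrow> 0" by simp
  ultimately have "(\<lambda>N. mean_factor N n) \<longlonglongrightarrow> 0"
    by (rule Lim_null_comparison[OF always_eventually[OF allI]])
  then show ?thesis using False by simp
qed

text \<open>Averaging the inner automorphisms of the monomials \<open>e (j, l)\<close> with \<open>j, l < N\<close> does not increase the norm
  and, \<open>\<theta>\<close> being irrational, removes every coefficient but the one at \<open>0\<close> in the limit.\<close>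

lemma norm_coeff0_le_finite:
  assumes F: "finite F" "0 \<in> F"
  shows "cmod (c 0) \<le> norm (\<Sum>k\<in>F. c k *\<^sub>C e k)"
proof -
  define x where "x = (\<Sum>k\<in>F. c k *\<^sub>C e k)"
  define M where "M N = (1 / (real N)\<^sup>2) *\<^sub>R
    (\<Sum>j<N. \<Sum>l<N. e (int j, int l) * x * star (e (int j, int l)))" for N
  have M: "M N = (\<Sum>k\<in>F. (c k * (mean_factor N (snd k) * mean_factor N (- fst k))) *\<^sub>C e k)" for N
  proof -
    have "e (int j, int l) * x * star (e (int j, int l))
        = (\<Sum>k\<in>F. (c k * (phase \<theta> (int j * snd k) * phase \<theta> (int l * (- fst k)))) *\<^sub>C e k)" for j l
      by (simp add: x_def sum_distrib_left sum_distrib_right scaleC_mult_left scaleC_mult_right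
          e_conj scaleC_scaleC flip: phase_add)
    then have "M N = (1 / (real N)\<^sup>2) *\<^sub>R
        (\<Sum>j<N. \<Sum>l<N. \<Sum>k\<in>F. (c k * (phase \<theta> (int j * snd k) * phase \<theta> (int l * (- fst k)))) *\<^sub>C e k)"
      by (simp add: M_def)
    also have "\<dots> = (1 / (real N)\<^sup>2) *\<^sub>R
        (\<Sum>k\<in>F. \<Sum>j<N. \<Sum>l<N. (c k * (phase \<theta> (int j * snd k) * phase \<theta> (int l * (- fst k)))) *\<^sub>C e k)"
    proof -
      have "(\<Sum>j<N. \<Sum>l<N. \<Sum>k\<in>F. g j l k) = (\<Sum>k\<in>F. \<Sum>j<N. \<Sum>l<N. g j l k)" for g :: "nat \<Rightarrow> nat \<Rightarrow> grid \<Rightarrow> 'a"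
        by (subst sum.swap[of _ F "{..<N}"], subst sum.swap[of _ F "{..<N}"]) (rule refl)
      then show ?thesis by simp
    qed
    also have "\<dots> = (\<Sum>k\<in>F. (c k * (mean_factor N (snd k) * mean_factor N (- fst k))) *\<^sub>C e k)"
    proof -
      have "(1 / (real N)\<^sup>2) *\<^sub>R (\<Sum>j<N. \<Sum>l<N. (a * (p j * q l)) *\<^sub>C y)
          = (a * (((\<Sum>j<N. p j) / of_nat N) * ((\<Sum>l<N. q l) / of_nat N))) *\<^sub>C y"
        for a and p q :: "nat \<Rightarrow> complex" and y :: 'a
      proof -
        have "(1 / (real N)\<^sup>2) *\<^sub>R (\<Sum>j<N. \<Sum>l<N. (a * (p j * q l)) *\<^sub>C y)
            = complex_of_real (1 / (real N)\<^sup>2) *\<^sub>C ((a * ((\<Sum>j<N. p j) * (\<Sum>l<N. q l))) *\<^sub>C y)"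
        proof -
          have pq: "(\<Sum>j<N. p j) * (\<Sum>l<N. q l) = (\<Sum>j<N. \<Sum>l<N. p j * q l)" by (rule sum_product)
          show ?thesis unfolding scaleC_of_real pq unfolding sum_distrib_left scaleC_sum_left ..
        qed
        then show ?thesis by (simp add: scaleC_scaleC power2_eq_square field_simps)
      qed
      then show ?thesis unfolding scaleR_sum_right mean_factor_def by simp
    qed
    finally show ?thesis .
  qed
  have lim: "M \<longlonglongrightarrow> (\<Sum>k\<in>F. (c k * ((if snd k = 0 then 1 else 0) * (if - fst k = 0 then 1 else 0))) *\<^sub>C e k)"
    unfolding M
    by (intro tendsto_sum bounded_linear.tendsto[OF bounded_linear_scaleC_left] tendsto_mult tendsto_const
        mean_factor_tendsto)
  have "(\<Sum>k\<in>F. (c k * ((if snd k = 0 then 1 else 0) * (if - fst k = 0 then 1 else 0))) *\<^sub>C e k)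
      = (\<Sum>k\<in>F. if k = 0 then c k *\<^sub>C e k else 0)"
    by (rule sum.cong[OF refl]) (auto simp: prod_eq_iff)
  also have "\<dots> = c 0 *\<^sub>C 1" using F by simp
  finally have "M \<longlonglongrightarrow> c 0 *\<^sub>C 1" using lim by simp
  then have "(\<lambda>N. norm (M N)) \<longlonglongrightarrow> norm (c 0 *\<^sub>C (1::'a))" by (rule tendsto_norm)
  moreover have "norm (M N) \<le> norm x" for N
  proof -
    have "norm (\<Sum>j<N. \<Sum>l<N. e (int j, int l) * x * star (e (int j, int l))) \<le> (\<Sum>j<N. \<Sum>l<N. norm x)"
      by (intro sum_norm_le norm_unitary_conj_le unitary_e)
    then have "norm (M N) \<le> (1 / (real N)\<^sup>2) * (real N * (real N * norm x))"
      unfolding M_def by (simp add: divide_right_mono)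
    also have "\<dots> \<le> norm x" by (simp add: power2_eq_square)
    finally show ?thesis .
  qed
  ultimately have "norm (c 0 *\<^sub>C (1::'a)) \<le> norm x"
    by (meson LIMSEQ_le_const2)
  then show ?thesis by (simp add: norm_scaleC x_def)
qed

text \<open>Multiplication by the unitary \<open>e (- k)\<close> moves the coefficient at \<open>k\<close> to \<open>0\<close>.\<close>

lemma norm_coeff_le:
  assumes c: "weight_summable 0 c"
  shows "cmod (c k) \<le> norm (rep c)"
proof -
  have zero: "cmod (d 0) \<le> norm (rep d)" if d: "weight_summable 0 d" for d
  proof (rule tendsto_lowerbound)
    show "((\<lambda>F. norm (\<Sum>k\<in>F. d k *\<^sub>C e k)) \<longlongrightarrow> norm (rep d)) (finite_subsets_at_top UNIV)"
      using rep_has_sum[OF d] unfolding has_sum_def by (rule tendsto_norm)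
    show "\<forall>\<^sub>F F in finite_subsets_at_top UNIV. cmod (d 0) \<le> norm (\<Sum>k\<in>F. d k *\<^sub>C e k)"
      unfolding eventually_finite_subsets_at_top
      by (rule exI[of _ "{0}"]) (auto intro: norm_coeff0_le_finite)
  qed simp
  have "cmod (c k) = cmod (shift (- k) c 0)" by (simp add: shift_def norm_mult)
  also have "\<dots> \<le> norm (rep (shift (- k) c))" by (intro zero weight_summable_shift c)
  also have "\<dots> = norm (e (- k) * rep c)" by (simp add: e_mult_rep c)
  also have "\<dots> \<le> norm (rep c)" using norm_mult_ineq[of "e (- k)" "rep c"] by simp
  finally show ?thesis .
qed

definition coef :: "'a \<Rightarrow> grid \<Rightarrow> complex" where
  "coef x = (THE c. weight_summable 0 c \<and> rep c = x)"

text \<open>A consequence of the bound on coefficients, which thereby makes \<open>coef\<close> meaningful on all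
  absolutely convergent expansions.\<close>

lemma rep_inject:
  assumes "weight_summable 0 c" "weight_summable 0 d" "rep c = rep d"
  shows "c = d"
proof
  fix k
  have "cmod (c k - d k) \<le> norm (rep c - rep d)"
    using norm_coeff_le[OF weight_summable_diff[OF assms(1,2)], of k] rep_diff[OF assms(1,2)] by simp
  then show "c k = d k" using assms(3) by simp
qed

lemma coef_rep: "weight_summable 0 c \<Longrightarrow> coef (rep c) = c"
  unfolding coef_def by (rule the_equality) (auto intro: rep_inject)

section \<open>Weighted Wiener algebras\<close>

text \<open>Elements with coefficients in \<open>\<ell>\<^sup>1\<close> for the \<open>s\<close>-th power of the weight. Each is a Banach algebra
  under \<open>wiener_norm s\<close>, and their intersection is the smooth subalgebra.\<close>

definition wiener :: "nat \<Rightarrow> 'a set" where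
  "wiener s = {x. \<exists>c. weight_summable s c \<and> x = rep c}"

definition wiener_norm :: "nat \<Rightarrow> 'a \<Rightarrow> real" where
  "wiener_norm s x = weight_norm s (coef x)"

lemma rep_in_wiener: "weight_summable s c \<Longrightarrow> rep c \<in> wiener s"
  by (auto simp: wiener_def)

lemma coef_rep': "weight_summable s c \<Longrightarrow> coef (rep c) = c"
  by (simp add: coef_rep weight_summable_0)

lemma wiener_D:
  assumes "x \<in> wiener s"
  shows "weight_summable s (coef x)" "weight_summable 0 (coef x)" "rep (coef x) = x"
  using assms weight_summable_0 by (auto simp: wiener_def coef_rep')

lemma wiener_mono: "x \<in> wiener s \<Longrightarrow> s' \<le> s \<Longrightarrow> x \<in> wiener s'"
  using wiener_D(1,3) weight_summable_mono rep_in_wiener by metis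

lemma wiener_has_sum: "x \<in> wiener s \<Longrightarrow> ((\<lambda>k. coef x k *\<^sub>C e k) has_sum x) UNIV"
  using rep_has_sum wiener_D(2,3) by metis

lemma norm_coef_le: "x \<in> wiener s \<Longrightarrow> cmod (coef x k) \<le> norm x"
  using norm_coeff_le wiener_D(2,3) by metis

lemma wiener_norm_nonneg: "wiener_norm s x \<ge> 0"
  by (simp add: wiener_norm_def weight_norm_nonneg)

lemma wiener_add:
  assumes "x \<in> wiener s" "y \<in> wiener s"
  shows "x + y \<in> wiener s" "coef (x + y) k = coef x k + coef y k" "wiener_norm s (x + y) \<le> wiener_norm s x + wiener_norm s y"
proof -
  have r: "x + y = rep (\<lambda>k. coef x k + coef y k)"
    using assms by (simp add: rep_add wiener_D)
  have w: "weight_summable s (\<lambda>k. coef x k + coef y k)" using assms by (simp add: weight_summable_add wiener_D)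
  show "x + y \<in> wiener s" unfolding r by (rule rep_in_wiener[OF w])
  show "coef (x + y) k = coef x k + coef y k" unfolding r coef_rep'[OF w] ..
  show "wiener_norm s (x + y) \<le> wiener_norm s x + wiener_norm s y"
    unfolding wiener_norm_def r coef_rep'[OF w] using assms by (intro weight_norm_add_le wiener_D)
qed

lemma wiener_scaleC:
  assumes "x \<in> wiener s"
  shows "z *\<^sub>C x \<in> wiener s" "coef (z *\<^sub>C x) k = z * coef x k" "wiener_norm s (z *\<^sub>C x) = cmod z * wiener_norm s x"
proof -
  have r: "z *\<^sub>C x = rep (\<lambda>k. z * coef x k)"
    using assms by (simp add: rep_cmult wiener_D)
  have w: "weight_summable s (\<lambda>k. z * coef x k)" using assms by (simp add: weight_summable_cmult wiener_D)
  show "z *\<^sub>C x \<in> wiener s" unfolding r by (rule rep_in_wiener[OF w])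
  show "coef (z *\<^sub>C x) k = z * coef x k" unfolding r coef_rep'[OF w] ..
  show "wiener_norm s (z *\<^sub>C x) = cmod z * wiener_norm s x" unfolding wiener_norm_def r coef_rep'[OF w] weight_norm_cmult ..
qed

lemma wiener_scaleR:
  assumes "x \<in> wiener s"
  shows "a *\<^sub>R x \<in> wiener s" "coef (a *\<^sub>R x) k = of_real a * coef x k" "wiener_norm s (a *\<^sub>R x) = \<bar>a\<bar> * wiener_norm s x"
  using wiener_scaleC[OF assms, of "of_real a"] by (simp_all add: scaleC_of_real)

lemma wiener_diff:
  assumes "x \<in> wiener s" "y \<in> wiener s"
  shows "x - y \<in> wiener s" "coef (x - y) k = coef x k - coef y k" "wiener_norm s (x - y) \<le> wiener_norm s x + wiener_norm s y"
  using wiener_add[of x s "(-1) *\<^sub>R y"] wiener_scaleR[OF assms(2), of "-1"] assms by simp_all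

lemma wiener_1: "1 \<in> wiener s" "coef 1 k = (if k = 0 then 1 else 0)" "wiener_norm s 1 = 1"
proof -
  define c :: "grid \<Rightarrow> complex" where "c k = (if k = 0 then 1 else 0)" for k
  have w: "weight_summable s c" for s by (rule weight_summable_finite) (simp add: c_def)
  have r: "rep c = 1" by (subst rep_finite[of "{0}"]) (auto simp: c_def)
  show "1 \<in> wiener s" using rep_in_wiener[OF w] r by simp
  show "coef 1 k = (if k = 0 then 1 else 0)" using coef_rep'[OF w] r c_def by metis
  have "wiener_norm s 1 = (\<Sum>\<^sub>\<infinity>k. weight k ^ s * cmod (c k))"
    using coef_rep'[OF w] r by (simp add: wiener_norm_def weight_norm_def)
  also have "\<dots> = (\<Sum>\<^sub>\<infinity>k\<in>{0}. weight k ^ s * cmod (c k))"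
    by (rule infsum_cong_neutral) (auto simp: c_def)
  finally show "wiener_norm s 1 = 1" by (simp add: c_def)
qed

text \<open>Completeness, in the form of convergence of absolutely convergent series. Sums over arbitrary
  index types serve the product, with the grid as index, as well as the exponential and the iteration.
  All claims come from one absolutely summable family on the product of the index type with the grid.\<close>

lemma wiener_series:
  fixes x :: "'i \<Rightarrow> 'a"
  assumes x: "\<And>i. x i \<in> wiener s" and sm: "(\<lambda>i. wiener_norm s (x i)) summable_on UNIV"
  obtains y where "y \<in> wiener s" "(x has_sum y) UNIV" "wiener_norm s y \<le> (\<Sum>\<^sub>\<infinity>i. wiener_norm s (x i))"
    "\<And>k. coef y k = (\<Sum>\<^sub>\<infinity>i. coef (x i) k)"
proof -
  define c where "c i = coef (x i)" for i
  define f where "f = (\<lambda>(i, k). weight k ^ s * cmod (c i k))"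
  define F where "F = (\<lambda>(i, k). c i k *\<^sub>C e k)"
  have fs: "f summable_on UNIV \<times> UNIV"
  proof (rule summable_on_SigmaI)
    show "((\<lambda>k. f (i, k)) has_sum wiener_norm s (x i)) UNIV" for i
      using wiener_D(1)[OF x[of i]] unfolding wiener_norm_def weight_norm_def f_def c_def weight_summable_def by (simp add: has_sum_infsum)
  qed (use sm in \<open>auto simp: f_def\<close>)
  have fs': "(\<lambda>(k, i). f (i, k)) summable_on UNIV \<times> UNIV"
    using summable_on_swap[of f UNIV UNIV] fs by simp
  define g where "g k = (\<Sum>\<^sub>\<infinity>i. f (i, k))" for k
  have gs: "g summable_on UNIV"
    using summable_on_Sigma_banach[OF fs'] by (simp add: g_def[abs_def])
  have "infsum g UNIV = (\<Sum>\<^sub>\<infinity>i. \<Sum>\<^sub>\<infinity>k. f (i, k))"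
    unfolding g_def using infsum_swap_banach[OF fs'] by simp
  also have "\<dots> = (\<Sum>\<^sub>\<infinity>i. wiener_norm s (x i))"
    by (simp add: wiener_norm_def weight_norm_def f_def c_def)
  finally have gsum: "infsum g UNIV = (\<Sum>\<^sub>\<infinity>i. wiener_norm s (x i))" .
  have fk: "(\<lambda>i. f (i, k)) summable_on UNIV" for k
    using summable_on_SigmaD1[where f="\<lambda>k i. f (i, k)" and A=UNIV and B="\<lambda>_. UNIV", OF fs'] by simp
  have ck_abs: "(\<lambda>i. cmod (c i k)) summable_on UNIV" for k
    by (rule summable_on_comparison_test[OF fk[of k]])
       (auto simp: f_def weight_ge_1 intro: mult_left_le[of _ _, THEN order_trans] one_le_power
         mult_right_mono[of 1 _ "cmod _", simplified])
  have ck: "(\<lambda>i. c i k) summable_on UNIV" for k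
    using ck_abs by (rule abs_summable_summable)
  define d where "d k = (\<Sum>\<^sub>\<infinity>i. c i k)" for k
  have dg: "weight k ^ s * cmod (d k) \<le> g k" for k
  proof -
    have "cmod (d k) \<le> (\<Sum>\<^sub>\<infinity>i. cmod (c i k))"
      unfolding d_def by (rule norm_infsum_bound[OF ck_abs])
    then have "weight k ^ s * cmod (d k) \<le> weight k ^ s * (\<Sum>\<^sub>\<infinity>i. cmod (c i k))"
      by (rule mult_left_mono) simp
    then show ?thesis by (simp add: g_def f_def infsum_cmult_right')
  qed
  have wd: "weight_summable s d" unfolding weight_summable_def
    by (rule summable_on_comparison_test[OF gs]) (use dg in auto)
  have nd: "weight_norm s d \<le> (\<Sum>\<^sub>\<infinity>i. wiener_norm s (x i))"
    unfolding weight_norm_def gsum[symmetric] by (rule infsum_mono[OF wd[unfolded weight_summable_def] gs dg])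
  have "(\<lambda>p. norm (F p)) summable_on UNIV \<times> UNIV"
    by (rule summable_on_comparison_test[OF fs])
       (auto simp: F_def f_def norm_scaleC weight_ge_1 one_le_power mult_right_mono[of 1 _ "cmod _", simplified])
  then have Fs: "F summable_on UNIV \<times> UNIV" by (rule abs_summable_summable)
  then obtain T where T: "(F has_sum T) (UNIV \<times> UNIV)" by (auto simp: summable_on_def)
  have xT: "(x has_sum T) UNIV"
    by (rule has_sum_SigmaD[OF T]) (use wiener_has_sum[OF x] in \<open>simp add: F_def c_def\<close>)
  have "((\<lambda>k. d k *\<^sub>C e k) has_sum T) UNIV"
  proof (rule has_sum_SigmaD)
    show "((\<lambda>(k, i). F (i, k)) has_sum T) (UNIV \<times> UNIV)"
      using has_sum_swap[where f=F and S=T and A=UNIV and B=UNIV] T by simp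
    show "((\<lambda>i. case (k, i) of (k, i) \<Rightarrow> F (i, k)) has_sum d k *\<^sub>C e k) UNIV" for k
      using has_sum_bounded_linear[OF bounded_linear_scaleC_left[of "e k"] has_sum_infsum[OF ck[of k]]]
      by (simp add: F_def d_def)
  qed
  then have Td: "T = rep d" using rep_eqI by blast
  show thesis
  proof (rule that[of T])
    show "T \<in> wiener s" unfolding Td by (rule rep_in_wiener[OF wd])
    show "(x has_sum T) UNIV" by (rule xT)
    show "wiener_norm s T \<le> (\<Sum>\<^sub>\<infinity>i. wiener_norm s (x i))" using nd by (simp add: wiener_norm_def Td coef_rep'[OF wd])
    show "coef T k = (\<Sum>\<^sub>\<infinity>i. coef (x i) k)" for k
      by (simp add: Td coef_rep'[OF wd] d_def c_def)
  qed
qed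

lemma wiener_e_mult:
  assumes "y \<in> wiener s"
  shows "e j * y \<in> wiener s" "wiener_norm s (e j * y) \<le> weight j ^ s * wiener_norm s y"
    "coef (e j * y) k = cocycle j (k - j) * coef y (k - j)"
proof -
  have r: "e j * y = rep (shift j (coef y))"
    using e_mult_rep[of "coef y" j] wiener_D[OF assms] by simp
  have w: "weight_summable s (shift j (coef y))" using weight_summable_shift wiener_D[OF assms] by simp
  show "e j * y \<in> wiener s" unfolding r by (rule rep_in_wiener[OF w])
  show "wiener_norm s (e j * y) \<le> weight j ^ s * wiener_norm s y"
    unfolding wiener_norm_def r coef_rep'[OF w] using wiener_D[OF assms] by (simp add: weight_summable_shift)
  show "coef (e j * y) k = cocycle j (k - j) * coef y (k - j)"
    unfolding r coef_rep'[OF w] by (simp add: shift_def)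
qed

text \<open>The product is the series of the terms \<open>coef x j *\<^sub>C (e j * y)\<close>, each of which only shifts the
  coefficients of \<open>y\<close>.\<close>

lemma wiener_mult:
  assumes x: "x \<in> wiener s" and y: "y \<in> wiener s"
  shows "x * y \<in> wiener s" "wiener_norm s (x * y) \<le> wiener_norm s x * wiener_norm s y"
    "coef (x * y) k = (\<Sum>\<^sub>\<infinity>j. coef x j * (cocycle j (k - j) * coef y (k - j)))"
proof -
  define X where "X j = coef x j *\<^sub>C (e j * y)" for j
  define b where "b j = (weight j ^ s * cmod (coef x j)) * wiener_norm s y" for j
  have XW: "X j \<in> wiener s" for j unfolding X_def by (intro wiener_scaleC wiener_e_mult y)
  have bs: "b summable_on UNIV"
    unfolding b_def by (intro summable_on_cmult_left) (use wiener_D(1)[OF x] weight_summable_def in auto)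
  have bsum: "infsum b UNIV = wiener_norm s x * wiener_norm s y"
    unfolding b_def wiener_norm_def weight_norm_def[of s "coef x"] by (rule infsum_cmult_left')
  have le: "wiener_norm s (X j) \<le> b j" for j
    using mult_left_mono[OF wiener_e_mult(2)[OF y, of j], of "cmod (coef x j)"]
    by (simp add: X_def b_def wiener_scaleC(3)[OF wiener_e_mult(1)[OF y]] mult_ac)
  have sm: "(\<lambda>j. wiener_norm s (X j)) summable_on UNIV"
    by (rule summable_on_comparison_test[OF bs le wiener_norm_nonneg])
  have "((\<lambda>j. (coef x j *\<^sub>C e j) * y) has_sum (x * y)) UNIV"
    by (rule has_sum_bounded_linear[OF bounded_linear_mult_left wiener_has_sum[OF x]])
  then have norm2: "(X has_sum (x * y)) UNIV" by (simp add: X_def[abs_def] scaleC_mult_left)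
  obtain p where p: "p \<in> wiener s" "(X has_sum p) UNIV" "wiener_norm s p \<le> (\<Sum>\<^sub>\<infinity>j. wiener_norm s (X j))"
    "\<And>k. coef p k = (\<Sum>\<^sub>\<infinity>j. coef (X j) k)"
    using wiener_series[OF XW sm] by blast
  have px: "p = x * y" using has_sum_unique[OF p(2) norm2] .
  show "x * y \<in> wiener s" using p px by simp
  have "(\<Sum>\<^sub>\<infinity>j. wiener_norm s (X j)) \<le> wiener_norm s x * wiener_norm s y"
    unfolding bsum[symmetric] by (rule infsum_mono[OF sm bs le])
  then show "wiener_norm s (x * y) \<le> wiener_norm s x * wiener_norm s y" using p px by simp
  show "coef (x * y) k = (\<Sum>\<^sub>\<infinity>j. coef x j * (cocycle j (k - j) * coef y (k - j)))"
    using p(4)[of k] wiener_scaleC(2)[OF wiener_e_mult(1)[OF y]] wiener_e_mult(3)[OF y] by (simp add: px X_def)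
qed

lemma bij_uminus: "bij (\<lambda>k::grid. - k)"
  by (rule bij_betw_byWitness[where f'="\<lambda>k. - k"]) auto

lemma wiener_star:
  assumes x: "x \<in> wiener s"
  shows "star x \<in> wiener s" "coef (star x) k = phase \<theta> (- (fst k * snd k)) * cnj (coef x (- k))"
proof -
  define d where "d k = phase \<theta> (- (fst k * snd k)) * cnj (coef x (- k))" for k
  have "weight_summable s (\<lambda>k. coef x (- k))"
    using wiener_D(1)[OF x] summable_on_reindex_bij_betw[OF bij_uminus, of "\<lambda>k. weight k ^ s * cmod (coef x k)"]
    by (simp add: weight_summable_def)
  then have w: "weight_summable s d" by (rule weight_summable_comparison[where B=1]) (simp add: d_def norm_mult)
  have "((\<lambda>k. star (coef x k *\<^sub>C e k)) has_sum star x) UNIV"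
    by (rule has_sum_bounded_linear[OF bounded_linear_star wiener_has_sum[OF x]])
  then have "((\<lambda>k. d (- k) *\<^sub>C e (- k)) has_sum star x) UNIV"
    by (simp add: star_scaleC star_e scaleC_scaleC d_def mult.commute)
  then have r: "rep d = star x"
    using has_sum_reindex_bij_betw[OF bij_uminus, of "\<lambda>k. d k *\<^sub>C e k" "star x"] by (intro rep_eqI) simp
  show "star x \<in> wiener s" using rep_in_wiener[OF w] r by simp
  show "coef (star x) k = phase \<theta> (- (fst k * snd k)) * cnj (coef x (- k))"
    using coef_rep'[OF w] r by (simp add: d_def)
qed

lemma wiener_power:
  assumes x: "x \<in> wiener s"
  shows "x ^ n \<in> wiener s" "wiener_norm s (x ^ n) \<le> wiener_norm s x ^ n"
proof (induction n)
  case (Suc n)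
  { case 1 then show ?case using Suc x by (simp add: wiener_mult)
  next case 2 then show ?case
      using wiener_mult(2)[OF x Suc(1)] mult_left_mono[OF Suc(2) wiener_norm_nonneg, of s x] by simp }
qed (simp_all add: wiener_1)

lemma wiener_exp:
  assumes x: "x \<in> wiener s"
  shows "exp x \<in> wiener s"
proof -
  define X where "X n = x ^ n /\<^sub>R fact n" for n
  have XW: "X n \<in> wiener s" for n unfolding X_def by (intro wiener_scaleR wiener_power x)
  have le: "wiener_norm s (X n) \<le> wiener_norm s x ^ n /\<^sub>R fact n" for n
    using wiener_power(2)[OF x, of n] by (simp add: X_def wiener_scaleR(3)[OF wiener_power(1)[OF x]])
  have "(\<lambda>n. wiener_norm s (X n)) summable_on UNIV"
    by (rule summable_nonneg_imp_summable_on[OF summable_comparison_test'[OF summable_exp_generic[of "wiener_norm s x"]]])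
       (use le in \<open>auto simp: wiener_norm_nonneg\<close>)
  then obtain y where y: "y \<in> wiener s" "(X has_sum y) UNIV"
    using wiener_series[of X, OF XW] by blast
  have "y = exp x"
    using has_sum_imp_sums[OF y(2)] exp_converges[of x] sums_unique2 unfolding X_def by blast
  then show ?thesis using y by simp
qed

section \<open>The canonical trace\<close>

lemma coef_mult_0: "x \<in> wiener s \<Longrightarrow> y \<in> wiener s \<Longrightarrow>
  coef (x * y) 0 = (\<Sum>\<^sub>\<infinity>j. phase \<theta> (fst j * snd j) * (coef x j * coef y (- j)))"
  by (simp add: wiener_mult(3) cocycle_def mult_ac)

text \<open>Traciality: the phase of \<open>e j * e (- j)\<close> does not change under \<open>j \<mapsto> - j\<close>.\<close>

lemma coef_mult_0_commute:
  assumes "x \<in> wiener s" "y \<in> wiener s"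
  shows "coef (x * y) 0 = coef (y * x) 0"
  unfolding coef_mult_0[OF assms] coef_mult_0[OF assms(2,1)]
  by (subst infsum_reindex_bij_betw[OF bij_uminus, symmetric]) (simp add: mult_ac)

lemma coef_sq_summable:
  assumes x: "x \<in> wiener s"
  shows "(\<lambda>k. (cmod (coef x k))\<^sup>2) summable_on UNIV"
proof (rule summable_on_comparison_test)
  show "(\<lambda>k. norm x * (weight k ^ 0 * cmod (coef x k))) summable_on UNIV"
    using wiener_D(2)[OF x] unfolding weight_summable_def by (rule summable_on_cmult_right)
qed (use norm_coef_le[OF x] in \<open>auto simp: power2_eq_square mult_right_mono\<close>)

text \<open>Parseval's identity.\<close>

lemma coef_star_mult_self_0:
  assumes x: "x \<in> wiener s"
  shows "coef (star x * x) 0 = of_real (\<Sum>\<^sub>\<infinity>k. (cmod (coef x k))\<^sup>2)"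
proof -
  have "coef (star x * x) 0 = (\<Sum>\<^sub>\<infinity>j. of_real ((cmod (coef x (- j)))\<^sup>2))"
    unfolding coef_mult_0[OF wiener_star(1)[OF x] x] wiener_star(2)[OF x]
    by (simp add: mult.assoc[symmetric] flip: phase_add) (simp only: complex_norm_square mult.commute flip: of_real_power)
  also have "\<dots> = (\<Sum>\<^sub>\<infinity>j. of_real ((cmod (coef x j))\<^sup>2))"
    by (rule infsum_reindex_bij_betw[OF bij_uminus])
  also have "\<dots> = of_real (\<Sum>\<^sub>\<infinity>k. (cmod (coef x k))\<^sup>2)"
    by (rule infsumI[OF has_sum_bounded_linear[OF bounded_linear_of_real has_sum_infsum[OF coef_sq_summable[OF x]]]])
  finally show ?thesis .
qed

sublocale trace: tracial_subalgebra "wiener 0" "\<lambda>x. Re (coef x 0)"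
proof
  fix x y :: 'a and c :: real
  assume x: "x \<in> wiener 0"
  show "c *\<^sub>R x \<in> wiener 0" "star x \<in> wiener 0" "exp x \<in> wiener 0"
    using x by (simp_all add: wiener_scaleR wiener_star wiener_exp)
  show "Re (coef (c *\<^sub>R x) 0) = c * Re (coef x 0)"
    using x by (simp add: wiener_scaleR)
  show "\<bar>Re (coef x 0)\<bar> \<le> norm x"
    using norm_coef_le[OF x, of 0] abs_Re_le_cmod order_trans by blast
  show "Re (coef (star x) 0) = Re (coef x 0)" using x by (simp add: wiener_star)
  show "0 \<le> Re (coef (star x * x) 0)"
    using x by (simp add: coef_star_mult_self_0 infsum_nonneg)
  assume y: "y \<in> wiener 0"
  show "x + y \<in> wiener 0" "x * y \<in> wiener 0" "Re (coef (x + y) 0) = Re (coef x 0) + Re (coef y 0)"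
    using x y by (simp_all add: wiener_add wiener_mult)
  show "Re (coef (x * y) 0) = Re (coef (y * x) 0)"
    unfolding coef_mult_0_commute[OF x y] ..
qed (rule wiener_1)

lemma norm2_sq_eq: "x \<in> wiener 0 \<Longrightarrow> (trace.norm2 x)\<^sup>2 = (\<Sum>\<^sub>\<infinity>k. (cmod (coef x k))\<^sup>2)"
  by (simp add: trace.norm2_sq coef_star_mult_self_0)

section \<open>The resolvent of the Laplacian\<close>

text \<open>The negative Laplacian is accretive in the C*-norm, which expresses the maximum principle. Its symbol is the
  limit of the symbols of the second differences \<open>(4 x - S x) / \<epsilon>\<^sup>2\<close>, where \<open>S\<close> is the sum of the four inner
  automorphisms by \<open>U\<^sup>\<plusminus>\<^sup>j\<close> and \<open>V\<^sup>\<plusminus>\<^sup>j\<close> and \<open>\<epsilon>\<close> is \<open>j \<theta>\<close> minus an integer close to it. Each of these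
  differences is accretive because \<open>S\<close> has norm at most \<open>4\<close>.\<close>

lemma norm_le_resolvent_finite:
  assumes F: "finite F"
  shows "K * norm (\<Sum>k\<in>F. c k *\<^sub>C e k) \<le> norm (\<Sum>k\<in>F. (of_real (K + lap_symbol k) * c k) *\<^sub>C e k)"
proof -
  obtain j p :: "nat \<Rightarrow> int" where jp: "\<And>i. of_int (j i) * \<theta> - of_int (p i) \<noteq> 0"
    "(\<lambda>i. of_int (j i) * \<theta> - of_int (p i)) \<longlonglongrightarrow> 0"
    using irrational_approximation[OF irrational] by blast
  define \<epsilon> where "\<epsilon> i = of_int (j i) * \<theta> - of_int (p i)" for i
  define x where "x = (\<Sum>k\<in>F. c k *\<^sub>C e k)"
  define A where "A l = e l * x * star (e l)" for l
  have A: "A l = (\<Sum>k\<in>F. (c k * phase \<theta> (fst l * snd k - snd l * fst k)) *\<^sub>C e k)" for l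
    by (simp add: A_def x_def sum_distrib_left sum_distrib_right scaleC_mult_left scaleC_mult_right
          e_conj scaleC_scaleC)
  have nA: "norm (A l) \<le> norm x" for l unfolding A_def by (rule norm_unitary_conj_le[OF unitary_e])
  have phase: "phase \<theta> (j i * n) + phase \<theta> (- (j i * n)) = of_real (2 * cos (2 * pi * of_int n * \<epsilon> i))" for i n
  proof -
    have "phase \<theta> (j i * n) + phase \<theta> (- (j i * n)) = of_real (2 * cos (2 * pi * \<theta> * of_int (j i * n)))"
      by (simp add: phase_def complex_eq_iff)
    also have "2 * pi * \<theta> * of_int (j i * n) = 2 * pi * of_int n * \<epsilon> i + 2 * pi * of_int (p i * n)"
      by (simp add: \<epsilon>_def algebra_simps)
    also have "cos \<dots> = cos (2 * pi * of_int n * \<epsilon> i)"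
    proof -
      have "cos (2 * pi * of_int (p i * n)) = 1" "sin (2 * pi * of_int (p i * n)) = 0"
        by (simp_all only: cos_int_2pin sin_int_2pin)
      then show ?thesis unfolding cos_add by simp
    qed
    finally show ?thesis .
  qed
  define S where "S i = A (j i, 0) + A (- j i, 0) + (A (0, j i) + A (0, - j i))" for i
  define g where "g i k = (2 - 2 * cos (2 * pi * of_int (fst k) * \<epsilon> i)) / (\<epsilon> i)\<^sup>2
      + (2 - 2 * cos (2 * pi * of_int (snd k) * \<epsilon> i)) / (\<epsilon> i)\<^sup>2" for i k
  define y where "y i = (K + 4 / (\<epsilon> i)\<^sup>2) *\<^sub>R x - (1 / (\<epsilon> i)\<^sup>2) *\<^sub>R S i" for i
  have S: "S i = (\<Sum>k\<in>F. (c k * of_real (2 * cos (2 * pi * of_int (fst k) * \<epsilon> i)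
      + 2 * cos (2 * pi * of_int (snd k) * \<epsilon> i))) *\<^sub>C e k)" for i
  proof -
    have "of_real (2 * cos (2 * pi * of_int m * \<epsilon> i) + 2 * cos (2 * pi * of_int n * \<epsilon> i))
        = phase \<theta> (j i * n) + phase \<theta> (- (j i * n)) + (phase \<theta> (- (j i * m)) + phase \<theta> (j i * m))" for m n
      unfolding of_real_add phase[symmetric] by (simp only: add_ac)
    then show ?thesis
      unfolding S_def A sum.distrib[symmetric] scaleC_add_left[symmetric] distrib_left[symmetric] by simp
  qed
  have y: "y i = (\<Sum>k\<in>F. (of_real (K + g i k) * c k) *\<^sub>C e k)" for i
    unfolding y_def S x_def scaleC_of_real[symmetric] scaleC_sum_right sum_subtractf[symmetric] scaleC_scaleC
      scaleC_diff_left[symmetric]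
    by (rule sum.cong[OF refl]) (simp add: g_def add_divide_distrib diff_divide_distrib algebra_simps)
  have "(\<lambda>i. g i k) \<longlonglongrightarrow> lap_symbol k" for k
    unfolding g_def lap_symbol_def
    by (intro tendsto_add second_difference_cos_tendsto) (use jp in \<open>simp_all add: \<epsilon>_def[abs_def]\<close>)
  then have "y \<longlonglongrightarrow> (\<Sum>k\<in>F. (of_real (K + lap_symbol k) * c k) *\<^sub>C e k)"
    unfolding y
    by (intro tendsto_sum bounded_linear.tendsto[OF bounded_linear_scaleC_left] tendsto_mult tendsto_const
        tendsto_of_real tendsto_add)
  then have lim: "(\<lambda>i. norm (y i)) \<longlonglongrightarrow> norm (\<Sum>k\<in>F. (of_real (K + lap_symbol k) * c k) *\<^sub>C e k)"
    by (rule tendsto_norm)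
  have "K * norm x \<le> norm (y i)" for i
  proof -
    define t where "t = 1 / (\<epsilon> i)\<^sup>2"
    have t: "t \<ge> 0" by (simp add: t_def)
    have "norm (S i) \<le> 4 * norm x"
      unfolding S_def using nA by (smt (verit) norm_triangle_ineq)
    then have "norm (t *\<^sub>R S i) \<le> t * (4 * norm x)" using t by (simp add: mult_left_mono)
    moreover have "norm ((K + 4 * t) *\<^sub>R x) \<ge> (K + 4 * t) * norm x" by (simp add: mult_right_mono)
    moreover have "norm (y i) \<ge> norm ((K + 4 * t) *\<^sub>R x) - norm (t *\<^sub>R S i)"
      using norm_triangle_ineq2[of "(K + 4 * t) *\<^sub>R x" "t *\<^sub>R S i"] by (simp add: y_def t_def)
    ultimately show ?thesis by (simp add: algebra_simps)
  qed
  then have "K * norm x \<le> norm (\<Sum>k\<in>F. (of_real (K + lap_symbol k) * c k) *\<^sub>C e k)"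
    by (intro LIMSEQ_le_const[OF lim]) auto
  then show ?thesis by (simp add: x_def)
qed

lemma wiener_eqI: "x \<in> wiener 0 \<Longrightarrow> y \<in> wiener 0 \<Longrightarrow> (\<And>k. coef x k = coef y k) \<Longrightarrow> x = y"
  using wiener_D(3) by (metis ext)

definition resolvent :: "real \<Rightarrow> 'a \<Rightarrow> 'a" where
  "resolvent K w = rep (\<lambda>k. coef w k / of_real (K + lap_symbol k))"

context
  fixes K :: real
  assumes K: "K > 0"
begin

lemma K_lap_pos: "K + lap_symbol k > 0"
  using K lap_symbol_nonneg[of k] by linarith

lemma cmod_K_lap: "cmod (of_real (K + lap_symbol k)) = K + lap_symbol k"
  using K_lap_pos[of k] by (simp only: norm_of_real abs_of_pos)

lemma resolvent_wiener:
  assumes w: "w \<in> wiener s"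
  shows "resolvent K w \<in> wiener (s + 2)" "coef (resolvent K w) k = coef w k / of_real (K + lap_symbol k)"
proof -
  have ws: "weight_summable (s + 2) (\<lambda>k. coef w k / of_real (K + lap_symbol k))"
  proof (rule weight_summable_comparison[OF wiener_D(1)[OF w], where B="3 / K + 3"])
    fix k
    have "(weight k)\<^sup>2 / (K + lap_symbol k) \<le> 3 / K + 3"
      using weight_sq_le[OF K, of k] K_lap_pos[of k] by (simp add: pos_divide_le_eq)
    then have "((weight k)\<^sup>2 / (K + lap_symbol k)) * (weight k ^ s * cmod (coef w k))
        \<le> (3 / K + 3) * (weight k ^ s * cmod (coef w k))"
      by (rule mult_right_mono) simp
    then show "weight k ^ (s + 2) * cmod (coef w k / of_real (K + lap_symbol k))
        \<le> (3 / K + 3) * (weight k ^ s * cmod (coef w k))"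
      unfolding norm_divide cmod_K_lap by (simp add: power_add power2_eq_square mult_ac)
  qed
  show "resolvent K w \<in> wiener (s + 2)" unfolding resolvent_def by (rule rep_in_wiener[OF ws])
  show "coef (resolvent K w) k = coef w k / of_real (K + lap_symbol k)"
    unfolding resolvent_def coef_rep'[OF ws] ..
qed

lemma resolvent_wiener_0: "w \<in> wiener s \<Longrightarrow> resolvent K w \<in> wiener s"
  using resolvent_wiener(1) wiener_mono by (metis le_add1)

lemma norm_resolvent_le:
  assumes w: "w \<in> wiener 0"
  shows "K * norm (resolvent K w) \<le> norm w"
proof (rule tendsto_le)
  let ?c = "\<lambda>k. coef w k / of_real (K + lap_symbol k)"
  show "((\<lambda>F. norm (\<Sum>k\<in>F. coef w k *\<^sub>C e k)) \<longlongrightarrow> norm w) (finite_subsets_at_top UNIV)"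
    using wiener_has_sum[OF w] unfolding has_sum_def by (rule tendsto_norm)
  have "((\<lambda>F. \<Sum>k\<in>F. ?c k *\<^sub>C e k) \<longlongrightarrow> resolvent K w) (finite_subsets_at_top UNIV)"
    using wiener_has_sum[OF resolvent_wiener_0[OF w]] unfolding has_sum_def resolvent_wiener(2)[OF w] .
  then show "((\<lambda>F. K * norm (\<Sum>k\<in>F. ?c k *\<^sub>C e k)) \<longlongrightarrow> K * norm (resolvent K w)) (finite_subsets_at_top UNIV)"
    by (intro tendsto_mult tendsto_const tendsto_norm)
  have "K * norm (\<Sum>k\<in>F. ?c k *\<^sub>C e k) \<le> norm (\<Sum>k\<in>F. coef w k *\<^sub>C e k)" if "finite F" for F
  proof -
    have "complex_of_real (K + lap_symbol k) * ?c k = coef w k" for k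
      using K_lap_pos[of k] by (metis less_irrefl nonzero_eq_divide_eq mult.commute of_real_eq_0_iff)
    then show ?thesis using norm_le_resolvent_finite[OF that, of K ?c] by simp
  qed
  then show "\<forall>\<^sub>F F in finite_subsets_at_top UNIV. K * norm (\<Sum>k\<in>F. ?c k *\<^sub>C e k) \<le> norm (\<Sum>k\<in>F. coef w k *\<^sub>C e k)"
    unfolding eventually_finite_subsets_at_top by auto
qed simp

lemma norm2_resolvent_le:
  assumes w: "w \<in> wiener 0"
  shows "K * trace.norm2 (resolvent K w) \<le> trace.norm2 w"
proof (rule power2_le_imp_le)
  have r: "resolvent K w \<in> wiener 0" by (rule resolvent_wiener_0[OF w])
  have "(cmod (coef (resolvent K w) k))\<^sup>2 * K\<^sup>2 \<le> (cmod (coef w k))\<^sup>2" for k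
  proof -
    have "cmod (coef (resolvent K w) k) * K \<le> cmod (coef (resolvent K w) k) * (K + lap_symbol k)"
      by (intro mult_left_mono) auto
    also have "\<dots> = cmod (coef w k)"
      unfolding resolvent_wiener(2)[OF w] norm_divide cmod_K_lap using K_lap_pos[of k] by simp
    finally have "(cmod (coef (resolvent K w) k) * K)\<^sup>2 \<le> (cmod (coef w k))\<^sup>2"
      using K by (intro power_mono) auto
    then show ?thesis by (simp add: power_mult_distrib)
  qed
  then have "(\<Sum>\<^sub>\<infinity>k. (cmod (coef (resolvent K w) k))\<^sup>2 * K\<^sup>2) \<le> (\<Sum>\<^sub>\<infinity>k. (cmod (coef w k))\<^sup>2)"
    using coef_sq_summable[OF w] coef_sq_summable[OF r]
    by (intro infsum_mono summable_on_cmult_left) auto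
  then show "(K * trace.norm2 (resolvent K w))\<^sup>2 \<le> (trace.norm2 w)\<^sup>2"
    unfolding power_mult_distrib norm2_sq_eq[OF w] norm2_sq_eq[OF r] infsum_cmult_left' by (simp add: mult.commute)
  show "0 \<le> trace.norm2 w" by (rule trace.norm2_nonneg[OF w])
qed

text \<open>In dimension two the inverse square of \<open>K + lap_symbol\<close> is summable over the grid, so the
  Cauchy-Schwarz inequality bounds the sum of the coefficients of the resolvent by the \<open>\<ell>\<^sup>2\<close> norm.\<close>

lemma wiener_norm_resolvent_le_norm2:
  shows "\<exists>C\<ge>0. \<forall>w\<in>wiener 0. wiener_norm 0 (resolvent K w) \<le> C * trace.norm2 w"
proof -
  define h where "h k = (1 / (K + lap_symbol k))\<^sup>2" for k
  define B where "B = (3 / K + 3)\<^sup>2"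
  have "h k \<le> B * (1 / weight k ^ 4)" for k
  proof -
    have "((weight k)\<^sup>2)\<^sup>2 \<le> ((3 / K + 3) * (K + lap_symbol k))\<^sup>2"
      using weight_sq_le[OF K, of k] by (intro power_mono) auto
    then have "weight k ^ 4 \<le> B * (K + lap_symbol k)\<^sup>2"
      by (simp add: B_def power_mult_distrib flip: power_mult)
    moreover have "weight k \<noteq> 0" using weight_pos(1)[of k] by linarith
    ultimately show ?thesis using K_lap_pos[of k] by (simp add: h_def power_divide divide_le_eq le_divide_eq)
  qed
  then have norm2: "h summable_on UNIV"
    by (intro summable_on_comparison_test[OF summable_on_cmult_right[OF weight_inverse_summable, of B]])
       (auto simp: h_def)
  define S where "S = infsum h UNIV"
  have S: "S \<ge> 0" unfolding S_def by (intro infsum_nonneg) (simp add: h_def)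
  show ?thesis
  proof (intro exI[of _ "(S + 1) / 2"] conjI ballI)
    show "(S + 1) / 2 \<ge> 0" using S by simp
    fix w assume w: "w \<in> wiener 0"
    have r: "resolvent K w \<in> wiener 0" by (rule resolvent_wiener_0[OF w])
    define H where "H = trace.norm2 w"
    have H: "H \<ge> 0" unfolding H_def by (rule trace.norm2_nonneg[OF w])
    have bound: "wiener_norm 0 (resolvent K w) \<le> \<eta> * ((S + 1) / 2)" if \<eta>: "\<eta> > H" for \<eta>
    proof -
      have \<eta>0: "\<eta> > 0" using \<eta> H by simp
      \<comment> \<open>termwise \<open>2 a b \<le> \<eta> a\<^sup>2 + b\<^sup>2 / \<eta>\<close>, with \<open>\<eta>\<close> slightly above the norm, which may be zero\<close>
      let ?g = "\<lambda>k. \<eta> / 2 * h k + (1 / (2 * \<eta>)) * (cmod (coef w k))\<^sup>2"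
      have gs: "?g summable_on UNIV"
        by (intro summable_on_add summable_on_cmult_right norm2 coef_sq_summable[OF w])
      have "wiener_norm 0 (resolvent K w) \<le> infsum ?g UNIV"
        unfolding wiener_norm_def weight_norm_def
      proof (rule infsum_mono[OF _ gs])
        show "(\<lambda>k. weight k ^ 0 * cmod (coef (resolvent K w) k)) summable_on UNIV"
          using wiener_D(2)[OF r] by (simp add: weight_summable_def)
        fix k
        define a b where "a = 1 / (K + lap_symbol k)" and "b = cmod (coef w k)"
        have "0 \<le> (\<eta> * a - b)\<^sup>2" by simp
        then have "2 * \<eta> * (a * b) \<le> \<eta>\<^sup>2 * a\<^sup>2 + b\<^sup>2"
          by (simp add: power2_eq_square algebra_simps)
        then have "a * b \<le> \<eta> / 2 * a\<^sup>2 + (1 / (2 * \<eta>)) * b\<^sup>2"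
          using \<eta>0 by (simp add: field_simps power2_eq_square)
        moreover have "cmod (coef (resolvent K w) k) = a * b"
          unfolding resolvent_wiener(2)[OF w] norm_divide cmod_K_lap a_def b_def by simp
        ultimately show "weight k ^ 0 * cmod (coef (resolvent K w) k) \<le> ?g k"
          by (simp add: h_def a_def b_def)
      qed
      also have "infsum ?g UNIV = \<eta> / 2 * S + (1 / (2 * \<eta>)) * H\<^sup>2"
        unfolding S_def H_def norm2_sq_eq[OF w] infsum_cmult_right'[symmetric]
        by (intro infsum_add summable_on_cmult_right norm2 coef_sq_summable[OF w])
      also have "(1 / (2 * \<eta>)) * H\<^sup>2 \<le> (1 / (2 * \<eta>)) * \<eta>\<^sup>2"
        using \<eta> H \<eta>0 by (intro mult_left_mono power_mono) auto
      also have "(1 / (2 * \<eta>)) * \<eta>\<^sup>2 = \<eta> / 2" using \<eta>0 by (simp add: power2_eq_square)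
      finally show ?thesis by (simp add: algebra_simps add_divide_distrib)
    qed
    have "wiener_norm 0 (resolvent K w) / ((S + 1) / 2) \<le> H"
    proof (rule dense_ge)
      fix \<eta> assume "H < \<eta>"
      from bound[OF this] show "wiener_norm 0 (resolvent K w) / ((S + 1) / 2) \<le> \<eta>"
        using S by (simp add: pos_divide_le_eq)
    qed
    then show "wiener_norm 0 (resolvent K w) \<le> (S + 1) / 2 * trace.norm2 w"
      using S by (simp add: H_def field_simps)
  qed
qed

lemma resolvent_diff:
  assumes "w \<in> wiener 0" "w' \<in> wiener 0"
  shows "resolvent K (w - w') = resolvent K w - resolvent K w'"
  by (rule wiener_eqI) (use assms in \<open>simp_all add: wiener_diff[of _ 0] resolvent_wiener_0 resolvent_wiener(2)[of _ 0] diff_divide_distrib\<close>)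

lemma star_resolvent:
  assumes "w \<in> wiener 0"
  shows "star (resolvent K w) = resolvent K (star w)"
  by (rule wiener_eqI) (use assms in \<open>simp_all add: wiener_star[of _ 0] resolvent_wiener_0 resolvent_wiener(2)[of _ 0]\<close>)

end

section \<open>The fixed point\<close>

definition smooth :: "'a set" where
  "smooth = (\<Inter>s. wiener s)"

lemma smooth_wiener: "x \<in> smooth \<Longrightarrow> x \<in> wiener s"
  by (simp add: smooth_def)

lemma coef_le_norm2:
  assumes "x \<in> wiener 0"
  shows "cmod (coef x k) \<le> trace.norm2 x"
proof (rule power2_le_imp_le[OF _ trace.norm2_nonneg[OF assms]])
  have "(\<Sum>k\<in>{k}. (cmod (coef x k))\<^sup>2) \<le> (\<Sum>\<^sub>\<infinity>k. (cmod (coef x k))\<^sup>2)"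
    by (rule finite_sum_le_infsum[OF coef_sq_summable[OF assms]]) auto
  then show "(cmod (coef x k))\<^sup>2 \<le> (trace.norm2 x)\<^sup>2" by (simp add: norm2_sq_eq[OF assms])
qed

lemma norm2_le_norm:
  assumes "x \<in> wiener 0"
  shows "trace.norm2 x \<le> norm x"
proof -
  have "trace.norm2 1 = 1" unfolding trace.norm2_def by (simp add: wiener_1)
  then show ?thesis using trace.norm2_mult_left[OF assms wiener_1(1)] by simp
qed

context
  fixes a :: 'a and \<kappa> r K :: real
  assumes a: "a \<in> smooth" "star a = a" "norm (a - (\<kappa> * cosh r) *\<^sub>R 1) \<le> \<kappa> * sinh r"
    and \<kappa>: "\<kappa> > 0" and r: "r > 0" and K: "K \<ge> \<kappa> * exp (3 * r)"
begin

definition ball_sa :: "'a set" where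
  "ball_sa = {u \<in> wiener 0. star u = u \<and> norm u \<le> r}"

definition liouville_rhs :: "'a \<Rightarrow> 'a" where
  "liouville_rhs u = K *\<^sub>R u - \<kappa> *\<^sub>R exp u + a"

definition step :: "'a \<Rightarrow> 'a" where
  "step u = resolvent K (liouville_rhs u)"

lemma K_pos: "K > 0"
  using \<kappa> K by (smt (verit) exp_gt_zero mult_pos_pos)

lemma liouville_rhs_wiener: "u \<in> wiener s \<Longrightarrow> liouville_rhs u \<in> wiener s"
  unfolding liouville_rhs_def by (intro wiener_add wiener_diff wiener_scaleR wiener_exp smooth_wiener[OF a(1)])

lemma step_wiener: "u \<in> wiener s \<Longrightarrow> step u \<in> wiener (s + 2)"
  unfolding step_def by (intro resolvent_wiener K_pos liouville_rhs_wiener)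

text \<open>The bounds on the two parts of the right-hand side, one centred at \<open>\<kappa> cosh r\<close> and the other
  at \<open>0\<close>, add up to \<open>K r\<close>.\<close>

lemma step_ball:
  assumes u: "u \<in> ball_sa"
  shows "step u \<in> ball_sa"
proof -
  have uW: "u \<in> wiener 0" and su: "star u = u" and nu: "norm u \<le> r" using u by (auto simp: ball_sa_def)
  have gW: "liouville_rhs u \<in> wiener 0" by (rule liouville_rhs_wiener[OF uW])
  have wiener: "step u \<in> wiener 0" unfolding step_def by (rule resolvent_wiener_0[OF K_pos gW])
  have "star (liouville_rhs u) = liouville_rhs u"
    by (simp add: liouville_rhs_def star_add star_diff star_scaleR star_exp su a)
  then have s: "star (step u) = step u" unfolding step_def by (simp add: star_resolvent[OF K_pos gW])
  have "liouville_rhs u = (K *\<^sub>R u - \<kappa> *\<^sub>R (exp u - cosh r *\<^sub>R 1)) + (a - (\<kappa> * cosh r) *\<^sub>R 1)"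
    by (simp add: liouville_rhs_def algebra_simps)
  then have "norm (liouville_rhs u) \<le> (K * r - \<kappa> * sinh r) + \<kappa> * sinh r"
    using norm_exp_perturbation_le[OF su nu \<kappa> K r] a(3) norm_triangle_le add_mono by metis
  then have "K * norm (step u) \<le> K * r"
    using norm_resolvent_le[OF K_pos gW] by (simp add: step_def)
  then have "norm (step u) \<le> r" using K_pos by simp
  then show ?thesis using wiener s by (simp add: ball_sa_def)
qed

text \<open>The Lipschitz constant of \<open>step\<close> for the trace norm.\<close>

definition rate :: real where
  "rate = sqrt (1 - \<kappa> * exp (- r) / K)"

lemma rate: "0 \<le> rate" "rate < 1"
proof -
  have "\<kappa> * exp (- r) \<le> \<kappa> * exp (3 * r)" using \<kappa> r by simp
  also have "\<dots> \<le> K" by (rule K)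
  finally show "0 \<le> rate" using K_pos by (simp add: rate_def)
  show "rate < 1" using K_pos \<kappa> by (simp add: rate_def)
qed

lemma norm2_rhs_diff_le:
  assumes u: "u \<in> ball_sa" and v: "v \<in> ball_sa"
  shows "trace.norm2 (liouville_rhs u - liouville_rhs v) \<le> K * rate * trace.norm2 (u - v)"
proof -
  have D: "liouville_rhs u - liouville_rhs v = K *\<^sub>R (u - v) - \<kappa> *\<^sub>R (exp u - exp v)"
    by (simp add: liouville_rhs_def algebra_simps)
  have S: "u - v \<in> wiener 0" using u v by (simp add: ball_sa_def wiener_diff)
  have "(K * rate)\<^sup>2 = K\<^sup>2 * (1 - \<kappa> * exp (- r) / K)"
    using rate(1) unfolding rate_def by (simp add: power_mult_distrib)
  also have "\<dots> = K\<^sup>2 - K * \<kappa> * exp (- r)"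
    using K_pos by (simp add: field_simps power2_eq_square)
  finally have "(trace.norm2 (liouville_rhs u - liouville_rhs v))\<^sup>2 \<le> (K * rate * trace.norm2 (u - v))\<^sup>2"
    unfolding D power_mult_distrib[of "K * rate"]
    using trace.norm2_exp_perturbation_le[of u v r \<kappa> K] u v \<kappa> K by (simp add: ball_sa_def)
  then show ?thesis
    by (rule power2_le_imp_le) (use K_pos rate trace.norm2_nonneg[OF S] in simp)
qed

lemma step_diff:
  assumes u: "u \<in> ball_sa" and v: "v \<in> ball_sa"
  shows "step u - step v = resolvent K (liouville_rhs u - liouville_rhs v)"
    "liouville_rhs u - liouville_rhs v \<in> wiener 0"
  using u v liouville_rhs_wiener[of u 0] liouville_rhs_wiener[of v 0]
  by (simp_all add: step_def resolvent_diff[OF K_pos] ball_sa_def wiener_diff)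

lemma norm2_step_diff_le:
  assumes u: "u \<in> ball_sa" and v: "v \<in> ball_sa"
  shows "trace.norm2 (step u - step v) \<le> rate * trace.norm2 (u - v)"
proof -
  have "K * trace.norm2 (step u - step v) \<le> K * (rate * trace.norm2 (u - v))"
    unfolding step_diff[OF assms] mult.assoc[symmetric]
    using norm2_resolvent_le[OF K_pos step_diff(2)[OF assms]] norm2_rhs_diff_le[OF assms] by linarith
  then show ?thesis using K_pos by simp
qed

text \<open>The trace norm is not complete on the algebra. But the difference of two iterates is the resolvent of a
  difference of right-hand sides, whose trace norm decays geometrically; hence the differences are
  summable in \<open>wiener_norm 0\<close> and the limit \<open>l\<close> exists there. That \<open>l\<close> is fixed needs only its
  coefficients, for which the contraction suffices. Each application of \<open>step\<close> then gains two orders of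
  the weight.\<close>

lemma exists_fixed_point: "\<exists>u. u \<in> smooth \<and> star u = u \<and> step u = u"
proof -
  define u where "u n = (step ^^ n) 0" for n
  have u_Suc: "u (Suc n) = step (u n)" for n by (simp add: u_def)
  have "0 \<in> wiener 0" using wiener_diff(1)[OF wiener_1(1) wiener_1(1), of 0] by simp
  then have "u 0 \<in> ball_sa" using r by (simp add: u_def ball_sa_def)
  then have ub: "u n \<in> ball_sa" for n by (induction n) (simp_all add: u_Suc step_ball)
  define H where "H = trace.norm2 (u 1 - u 0)"
  have geo: "trace.norm2 (u (Suc n) - u n) \<le> rate ^ n * H" for n
  proof (induction n)
    case (Suc n)
    have "trace.norm2 (u (Suc (Suc n)) - u (Suc n)) \<le> rate * trace.norm2 (u (Suc n) - u n)"
      unfolding u_Suc[of "Suc n"] using norm2_step_diff_le[OF ub ub, of "Suc n" n] by (simp add: u_Suc)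
    also have "\<dots> \<le> rate * (rate ^ n * H)" using Suc rate by (intro mult_left_mono)
    finally show ?case by simp
  qed (simp add: H_def)
  obtain C where C: "C \<ge> 0" "\<And>w. w \<in> wiener 0 \<Longrightarrow> wiener_norm 0 (resolvent K w) \<le> C * trace.norm2 w"
    using wiener_norm_resolvent_le_norm2[OF K_pos] by blast
  \<comment> \<open>starting with the second difference, as the first one is not a resolvent of a difference\<close>
  define X where "X n = u (Suc (Suc n)) - u (Suc n)" for n
  have uW: "u n \<in> wiener 0" for n using ub[of n] by (simp add: ball_sa_def)
  have XW: "X n \<in> wiener 0" for n unfolding X_def by (intro wiener_diff uW)
  have Xle: "wiener_norm 0 (X n) \<le> C * (K * rate * H) * rate ^ n" for n
  proof -
    have "wiener_norm 0 (X n) \<le> C * trace.norm2 (liouville_rhs (u (Suc n)) - liouville_rhs (u n))"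
      using C(2)[OF step_diff(2)[OF ub ub], of "Suc n" n] step_diff(1)[OF ub ub, of "Suc n" n]
      by (simp add: X_def u_Suc)
    also have "\<dots> \<le> C * (K * rate * (rate ^ n * H))"
      using order_trans[OF norm2_rhs_diff_le[OF ub ub, of "Suc n" n] mult_left_mono[OF geo[of n], of "K * rate"]]
        K_pos rate C(1)
      by (intro mult_left_mono) auto
    finally show ?thesis by (simp add: mult_ac)
  qed
  have "(\<lambda>n. wiener_norm 0 (X n)) summable_on UNIV"
    by (rule summable_nonneg_imp_summable_on[OF summable_comparison_test'[OF
          summable_mult[OF summable_geometric[of rate], of "C * (K * rate * H)"]]])
       (use Xle rate in \<open>auto simp: wiener_norm_nonneg\<close>)
  then obtain y where y: "y \<in> wiener 0" "(X has_sum y) UNIV"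
    using wiener_series[of X 0, OF XW] by blast
  define l where "l = y + u 1"
  have lW: "l \<in> wiener 0" unfolding l_def by (intro wiener_add y uW)
  have "(\<lambda>N. \<Sum>n<N. X n) \<longlonglongrightarrow> y" using has_sum_imp_sums[OF y(2)] by (simp add: sums_def)
  moreover have "(\<Sum>n<N. X n) = u (Suc N) - u 1" for N
    unfolding X_def using sum_lessThan_telescope[of "\<lambda>n. u (Suc n)" N] by simp
  ultimately have "(\<lambda>N. (u (Suc N) - u 1) + u 1) \<longlonglongrightarrow> y + u 1"
    by (intro tendsto_add tendsto_const) simp
  then have ul': "(\<lambda>N. u (Suc N)) \<longlonglongrightarrow> l" by (simp add: l_def)
  then have ul: "u \<longlonglongrightarrow> l" by (simp only: filterlim_sequentially_Suc)
  have sl: "star l = l"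
  proof -
    have "(\<lambda>n. star (u n)) \<longlonglongrightarrow> star l" by (rule bounded_linear.tendsto[OF bounded_linear_star ul])
    then show ?thesis using ub ul LIMSEQ_unique by (auto simp: ball_sa_def)
  qed
  have "norm l \<le> r"
    by (rule LIMSEQ_le_const2[OF tendsto_norm[OF ul]]) (use ub in \<open>auto simp: ball_sa_def\<close>)
  then have lb: "l \<in> ball_sa" using sl lW by (simp add: ball_sa_def)
  have slW: "step l \<in> wiener 0" using step_ball[OF lb] by (simp add: ball_sa_def)
  have fp: "step l = l"
  proof (rule wiener_eqI[OF slW lW])
    fix k
    have "cmod (coef (step l - u (Suc n)) k) \<le> norm (l - u n)" for n
    proof -
      have d: "step l - u (Suc n) \<in> wiener 0" by (intro wiener_diff slW uW)
      have lu: "l - u n \<in> wiener 0" by (intro wiener_diff lW uW)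
      have "cmod (coef (step l - u (Suc n)) k) \<le> trace.norm2 (step l - u (Suc n))"
        by (rule coef_le_norm2[OF d])
      also have "\<dots> \<le> rate * trace.norm2 (l - u n)"
        unfolding u_Suc by (rule norm2_step_diff_le[OF lb ub])
      also have "\<dots> \<le> 1 * norm (l - u n)"
        using rate norm2_le_norm[OF lu] trace.norm2_nonneg[OF lu] by (intro mult_mono) auto
      finally show ?thesis by simp
    qed
    moreover have "(\<lambda>n. norm (l - u n)) \<longlonglongrightarrow> norm (l - l)"
      by (intro tendsto_norm tendsto_diff tendsto_const ul)
    then have "(\<lambda>n. norm (l - u n)) \<longlonglongrightarrow> 0" by simp
    ultimately have 1: "(\<lambda>n. coef (step l - u (Suc n)) k) \<longlonglongrightarrow> 0"
      by (rule Lim_null_comparison[OF always_eventually[OF allI]])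
    have 2: "(\<lambda>n. coef (l - u (Suc n)) k) \<longlonglongrightarrow> 0"
    proof (rule Lim_null_comparison[OF always_eventually[OF allI]])
      show "norm (coef (l - u (Suc n)) k) \<le> norm (l - u (Suc n))" for n
        by (rule norm_coef_le[OF wiener_diff(1)[OF lW uW]])
      have "(\<lambda>n. norm (l - u (Suc n))) \<longlonglongrightarrow> norm (l - l)"
        by (intro tendsto_norm tendsto_diff tendsto_const ul')
      then show "(\<lambda>n. norm (l - u (Suc n))) \<longlonglongrightarrow> 0" by simp
    qed
    have "(\<lambda>n. coef (step l) k - coef l k) \<longlonglongrightarrow> 0 - 0"
      using tendsto_diff[OF 1 2] by (simp add: wiener_diff(2)[OF slW uW] wiener_diff(2)[OF lW uW])
    then show "coef (step l) k = coef l k" by (simp add: LIMSEQ_const_iff)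
  qed
  have "l \<in> wiener (2 * n)" for n
  proof (induction n)
    case (Suc n)
    then show ?case using step_wiener[OF Suc] fp by simp
  qed (use lW in simp)
  then have "l \<in> smooth"
    unfolding smooth_def using wiener_mono[of l "2 * _"] by (metis INT_I UNIV_I le_add1 mult_2)
  then show ?thesis using sl fp by blast
qed

end

text \<open>The fixed point equation read off coefficientwise, where \<open>K\<close> cancels.\<close>

lemma exists_solution_coef:
  assumes a: "a \<in> smooth" "star a = a" "norm (a - (\<kappa> * cosh r) *\<^sub>R 1) \<le> \<kappa> * sinh r"
    and \<kappa>: "\<kappa> > 0" and r: "r > 0"
  shows "\<exists>u\<in>smooth. star u = u \<and> (\<forall>k. coef (\<kappa> *\<^sub>R exp u - a) k = - of_real (lap_symbol k) * coef u k)"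
proof -
  define K where "K = \<kappa> * exp (3 * r)"
  have K0: "K > 0" using \<kappa> by (simp add: K_def)
  have K: "K \<ge> \<kappa> * exp (3 * r)" by (simp add: K_def)
  obtain u where u: "u \<in> smooth" "star u = u"
    "resolvent K (K *\<^sub>R u - \<kappa> *\<^sub>R exp u + a) = u"
    using exists_fixed_point[OF a \<kappa> r K] unfolding step_def[OF a \<kappa> r K] liouville_rhs_def[OF a \<kappa> r K]
    by blast
  have wiener: "u \<in> wiener 0" "exp u \<in> wiener 0" "a \<in> wiener 0" using u a by (auto intro: smooth_wiener wiener_exp)
  have W2: "K *\<^sub>R u \<in> wiener 0" "\<kappa> *\<^sub>R exp u \<in> wiener 0" "K *\<^sub>R u - \<kappa> *\<^sub>R exp u \<in> wiener 0"
    "K *\<^sub>R u - \<kappa> *\<^sub>R exp u + a \<in> wiener 0"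
    by (intro wiener_add wiener_diff wiener_scaleR wiener)+
  have "coef (\<kappa> *\<^sub>R exp u - a) k = - of_real (lap_symbol k) * coef u k" for k
  proof -
    define q where "q = complex_of_real (K + lap_symbol k)"
    have q: "q \<noteq> 0" unfolding q_def using K_lap_pos[OF K0, of k] by (metis less_irrefl of_real_eq_0_iff)
    have "coef u k = coef (K *\<^sub>R u - \<kappa> *\<^sub>R exp u + a) k / q"
      using resolvent_wiener(2)[OF K0 W2(4), of k] u(3) by (simp only: q_def)
    then have "q * coef u k = coef (K *\<^sub>R u - \<kappa> *\<^sub>R exp u + a) k" using q by simp
    also have "\<dots> = of_real K * coef u k - of_real \<kappa> * coef (exp u) k + coef a k"
      using wiener W2 by (simp add: wiener_add(2)[of _ 0] wiener_diff(2)[of _ 0] wiener_scaleR(2)[of _ 0])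
    finally show ?thesis
      using wiener W2 by (simp add: q_def wiener_diff(2)[of _ 0] wiener_scaleR(2)[of _ 0] algebra_simps)
  qed
  then show ?thesis using u by blast
qed

section \<open>Smooth elements and derivations\<close>

lemma rapidly_decreasing_iff: "rapidly_decreasing c \<longleftrightarrow> (\<forall>s. weight_summable s c)"
proof
  assume r: "rapidly_decreasing c"
  show "\<forall>s. weight_summable s c"
  proof
    fix s
    obtain C where C: "(1 + \<bar>real_of_int m\<bar> + \<bar>real_of_int n\<bar>) ^ (s + 4) * cmod (c (m, n)) \<le> C" for m n
      using r unfolding rapidly_decreasing_def by metis
    show "weight_summable s c" unfolding weight_summable_def
    proof (rule summable_on_comparison_test[OF summable_on_cmult_right[OF weight_inverse_summable, of C]])
      fix k :: grid
      have "weight k ^ 4 * (weight k ^ s * cmod (c k)) \<le> C"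
        using C[of "fst k" "snd k"] by (simp add: weight_def power_add mult_ac)
      then show "weight k ^ s * cmod (c k) \<le> C * (1 / weight k ^ 4)"
        using weight_pos(1)[of k] by (simp add: pos_le_divide_eq mult.commute zero_less_power)
    qed simp
  qed
next
  assume w: "\<forall>s. weight_summable s c"
  show "rapidly_decreasing c" unfolding rapidly_decreasing_def
  proof (intro allI)
    fix s
    show "\<exists>C. \<forall>m n. (1 + \<bar>real_of_int m\<bar> + \<bar>real_of_int n\<bar>) ^ s * cmod (c (m, n)) \<le> C"
    proof (intro exI allI)
      fix m n
      have "(\<Sum>k\<in>{(m, n)}. weight k ^ s * cmod (c k)) \<le> weight_norm s c" unfolding weight_norm_def
        by (rule finite_sum_le_infsum) (use w in \<open>auto simp: weight_summable_def\<close>)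
      then show "(1 + \<bar>real_of_int m\<bar> + \<bar>real_of_int n\<bar>) ^ s * cmod (c (m, n)) \<le> weight_norm s c"
        by (simp add: weight_def)
    qed
  qed
qed

lemma expansion_terms: "(\<lambda>(m, n). c (m, n) *\<^sub>C (upow U m * upow V n)) = (\<lambda>k. c k *\<^sub>C e k)"
  by (auto simp: e_def)

lemma has_rot_expansion_iff: "has_rot_expansion U V c x \<longleftrightarrow> (\<forall>s. weight_summable s c) \<and> rep c = x"
  unfolding has_rot_expansion_def rapidly_decreasing_iff expansion_terms
  using rep_eqI rep_has_sum by blast

lemma rot_smooth_eq: "rot_smooth U V = smooth"
proof -
  have "rep c \<in> smooth" if "\<forall>s. weight_summable s c" for c
    using that by (simp add: smooth_def rep_in_wiener)
  moreover have "\<exists>c. (\<forall>s. weight_summable s c) \<and> rep c = x" if "x \<in> smooth" for x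
    using wiener_D(1)[OF smooth_wiener[OF that]] wiener_D(3)[OF smooth_wiener[OF that, of 0]] by blast
  ultimately show ?thesis
    unfolding rot_smooth_def has_rot_expansion_iff by auto
qed

lemma rot_coeff_eq:
  assumes "x \<in> smooth"
  shows "rot_coeff U V x = coef x"
  unfolding rot_coeff_def
proof (rule the_equality)
  show "has_rot_expansion U V (coef x) x"
    unfolding has_rot_expansion_iff by (simp add: wiener_D(1)[OF smooth_wiener[OF assms]] wiener_D(3)[OF smooth_wiener[OF assms, of 0]])
  show "c = coef x" if "has_rot_expansion U V c x" for c
    using that coef_rep[of c] unfolding has_rot_expansion_iff by auto
qed

text \<open>Both derivations multiply the coefficients by \<open>2 \<pi> i\<close> times a real factor bounded by the weight, and so
  preserve rapid decay.\<close>

lemma derivation_smooth: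
  assumes x: "x \<in> smooth" and p: "\<And>k. \<bar>p k\<bar> \<le> weight k"
  defines "y \<equiv> rep (\<lambda>k. (2 * of_real pi * \<i> * of_real (p k)) * coef x k)"
  shows "y \<in> smooth" "coef y k = (2 * of_real pi * \<i> * of_real (p k)) * coef x k"
proof -
  have w: "weight_summable s (\<lambda>k. (2 * of_real pi * \<i> * of_real (p k)) * coef x k)" for s
  proof (rule weight_summable_comparison[OF wiener_D(1)[OF smooth_wiener[OF x, of "s + 1"]], where B="2 * pi"])
    fix k
    have "\<bar>p k\<bar> * (weight k ^ s * (2 * pi) * cmod (coef x k)) \<le> weight k * (weight k ^ s * (2 * pi) * cmod (coef x k))"
      by (rule mult_right_mono[OF p]) simp
    then show "weight k ^ s * cmod ((2 * of_real pi * \<i> * of_real (p k)) * coef x k)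
        \<le> 2 * pi * (weight k ^ (s + 1) * cmod (coef x k))"
      by (simp add: norm_mult mult_ac)
  qed
  show "y \<in> smooth" unfolding y_def smooth_def using rep_in_wiener[OF w] by blast
  show "coef y k = (2 * of_real pi * \<i> * of_real (p k)) * coef x k"
    unfolding y_def coef_rep'[OF w[of 0]] ..
qed

lemma delta1_smooth:
  assumes x: "x \<in> smooth"
  shows "delta1 U V x \<in> smooth" "coef (delta1 U V x) k = (2 * of_real pi * \<i> * of_int (fst k)) * coef x k"
proof -
  have "(\<lambda>(m, n). (2 * of_real pi * \<i> * of_int m * coef x (m, n)) *\<^sub>C (upow U m * upow V n))
      = (\<lambda>k. ((2 * of_real pi * \<i> * of_real (real_of_int (fst k))) * coef x k) *\<^sub>C e k)"
    by (auto simp: e_def)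
  then have d: "delta1 U V x = rep (\<lambda>k. (2 * of_real pi * \<i> * of_real (real_of_int (fst k))) * coef x k)"
    unfolding delta1_def rot_coeff_eq[OF x] rep_def by (rule arg_cong)
  show "delta1 U V x \<in> smooth" "coef (delta1 U V x) k = (2 * of_real pi * \<i> * of_int (fst k)) * coef x k"
    using derivation_smooth[OF x, of "\<lambda>k. real_of_int (fst k)"] unfolding d by (auto simp: weight_def)
qed

lemma delta2_smooth:
  assumes x: "x \<in> smooth"
  shows "delta2 U V x \<in> smooth" "coef (delta2 U V x) k = (2 * of_real pi * \<i> * of_int (snd k)) * coef x k"
proof -
  have "(\<lambda>(m, n). (2 * of_real pi * \<i> * of_int n * coef x (m, n)) *\<^sub>C (upow U m * upow V n))
      = (\<lambda>k. ((2 * of_real pi * \<i> * of_real (real_of_int (snd k))) * coef x k) *\<^sub>C e k)"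
    by (auto simp: e_def)
  then have d: "delta2 U V x = rep (\<lambda>k. (2 * of_real pi * \<i> * of_real (real_of_int (snd k))) * coef x k)"
    unfolding delta2_def rot_coeff_eq[OF x] rep_def by (rule arg_cong)
  show "delta2 U V x \<in> smooth" "coef (delta2 U V x) k = (2 * of_real pi * \<i> * of_int (snd k)) * coef x k"
    using derivation_smooth[OF x, of "\<lambda>k. real_of_int (snd k)"] unfolding d by (auto simp: weight_def)
qed

lemma laplacian_wiener:
  assumes x: "x \<in> smooth"
  shows "laplacian U V x \<in> wiener 0" "coef (laplacian U V x) k = - of_real (lap_symbol k) * coef x k"
proof -
  have wiener: "delta1 U V (delta1 U V x) \<in> wiener 0" "delta2 U V (delta2 U V x) \<in> wiener 0"
    by (intro smooth_wiener delta1_smooth delta2_smooth x)+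
  show "laplacian U V x \<in> wiener 0" unfolding laplacian_def by (intro wiener_add wiener)
  show "coef (laplacian U V x) k = - of_real (lap_symbol k) * coef x k"
    unfolding laplacian_def wiener_add(2)[OF wiener]
    by (simp add: delta1_smooth delta2_smooth x lap_symbol_def power2_eq_square algebra_simps)
qed

text \<open>With \<open>t = norm a\<close>, the scaling \<open>\<kappa> cosh r = t\<close> makes the radius \<open>\<kappa> sinh r = t tanh r\<close> exceed
  \<open>norm (a - t)\<close> for large \<open>r\<close>, as the latter is smaller than \<open>t\<close>. Adding the scalar \<open>ln (\<kappa> / \<mu>)\<close> to the
  solution turns \<open>\<kappa> e\<^sup>u\<close> into \<open>\<mu> e\<^sup>u\<close> and does not change its Laplacian.\<close>

theorem liouville_solution:
  assumes a: "a \<in> rot_smooth U V" "positive_in (rot_algebra U V) a" "invertible_in (rot_smooth U V) a"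
    and \<mu>: "\<mu> > 0"
  shows "\<exists>u\<in>rot_smooth U V. star u = u \<and> laplacian U V u = \<mu> *\<^sub>R exp u - a"
proof -
  define t where "t = norm a"
  have as: "a \<in> smooth" using a rot_smooth_eq by simp
  have sa: "star a = a" using a by (simp add: positive_in_def)
  obtain a' where inv: "a * a' = 1" "a' * a = 1" using a(3) by (auto simp: invertible_in_def)
  have ball: "norm (a - t *\<^sub>R 1) < t"
    unfolding t_def by (rule positive_invertible_in_ball[OF a(2) inv])
  then have t: "t > 0" using norm_ge_zero[of "a - t *\<^sub>R 1"] by linarith
  have "eventually (\<lambda>r::real. norm (a - t *\<^sub>R 1) / t < tanh r \<and> r > 0) at_top"
    using ball t by (intro eventually_conj order_tendstoD(1)[OF tanh_real_at_top] eventually_gt_at_top) simp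
  then obtain r where r: "norm (a - t *\<^sub>R 1) / t < tanh r" "r > 0"
    using eventually_happens'[OF trivial_limit_at_top_linorder] by blast
  define \<kappa> where "\<kappa> = t / cosh r"
  have c0: "cosh r > 0" by (rule cosh_real_pos)
  have \<kappa>: "\<kappa> > 0" "\<kappa> * cosh r = t" "\<kappa> * sinh r = t * tanh r"
    using t c0 by (simp_all add: \<kappa>_def tanh_def)
  have "norm (a - (\<kappa> * cosh r) *\<^sub>R 1) \<le> \<kappa> * sinh r"
    using r(1) t unfolding \<kappa>(2,3) by (simp add: field_simps)
  then obtain u where u: "u \<in> smooth" "star u = u"
    "\<And>k. coef (\<kappa> *\<^sub>R exp u - a) k = - of_real (lap_symbol k) * coef u k"
    using exists_solution_coef[OF as sa _ \<kappa>(1) r(2)] by blast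
  define c where "c = ln (\<kappa> / \<mu>)"
  define v where "v = u + c *\<^sub>R 1"
  have uW: "u \<in> wiener s" for s using u(1) by (rule smooth_wiener)
  have cW: "c *\<^sub>R 1 \<in> wiener s" for s by (intro wiener_scaleR wiener_1)
  have vs: "v \<in> smooth" unfolding smooth_def v_def using wiener_add(1)[OF uW cW] by blast
  have cv: "coef v k = coef u k + of_real c * (if k = 0 then 1 else 0)" for k
    unfolding v_def using wiener_add(2)[OF uW[of 0] cW[of 0]] by (simp add: wiener_scaleR(2)[OF wiener_1(1)] wiener_1(2))
  have "exp v = exp u * exp (c *\<^sub>R 1)" unfolding v_def by (rule exp_add_commuting) simp
  also have "exp (c *\<^sub>R (1::'a)) = (\<kappa> / \<mu>) *\<^sub>R 1"
    using \<kappa> \<mu> by (simp add: exp_scaleR_one c_def)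
  finally have ev: "\<mu> *\<^sub>R exp v = \<kappa> *\<^sub>R exp u" using \<mu> by simp
  have "laplacian U V v = \<kappa> *\<^sub>R exp u - a"
  proof (rule wiener_eqI)
    show "laplacian U V v \<in> wiener 0" by (rule laplacian_wiener[OF vs])
    show "\<kappa> *\<^sub>R exp u - a \<in> wiener 0" by (intro wiener_diff wiener_scaleR wiener_exp uW smooth_wiener as)
    show "coef (laplacian U V v) k = coef (\<kappa> *\<^sub>R exp u - a) k" for k
      unfolding laplacian_wiener(2)[OF vs] u(3) cv by simp
  qed
  then have "laplacian U V v = \<mu> *\<^sub>R exp v - a" by (simp add: ev)
  moreover have "star v = v" by (simp add: v_def star_add star_scaleR u(2))
  ultimately show ?thesis using vs rot_smooth_eq by blast
qed

end

section \<open>The Liouville equation on the irrational rotation algebra\<close>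

theorem theorem4p4:
  fixes \<theta> \<mu> :: real and U V a :: "'a::cstar_algebra"
  assumes "\<theta> \<notin> \<rat>"
    and "universal_rotation_pair \<theta> U V"
    and "a \<in> rot_smooth U V"
    and "positive_in (rot_algebra U V) a"
    and "invertible_in (rot_smooth U V) a"
    and "\<mu> > 0"
  shows "\<exists>u\<in>rot_smooth U V. star u = u \<and> laplacian U V u = \<mu> *\<^sub>R exp u - a"
proof -
  interpret rotation_pair \<theta> U V
    using assms(1,2) by unfold_locales (auto simp: universal_rotation_pair_def)
  show ?thesis using assms(3-6) by (rule liouville_solution)
qed

end
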